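(* Let $1\le p,q<\infty$. Assume that $\Phi=(\phi_1,\dots,\phi_r)^T\in W_0(L^{1,1})^{(r)}$ has compact support (each $\phi_i$ has compact support) and that $P$ is a bounded projection from $L^{p,q}(\mathbb{R}^{d+1})$ onto $V_{p,q}(\Phi)$. Let the averaging sampling functions $\psi_{x_j,y_k}\in W(L^{1,1})$ satisfy $\int_{\mathbb{R}^{d+1}}\psi_{x_j,y_k}=1$ and $\int_{\mathbb{R}^{d+1}}|\psi_{x_j,y_k}|\le M$, where $M>0$ is independent of $(x_j,y_k)$. Then there exist a density $\gamma_0=\gamma_0(\Phi,M)>0$ and $a_0=a_0(\Phi,M)>0$ such that if $X=\{(x_j,y_k):j,k\in\mathbb{J}\}$ is $\gamma$-dense in $\mathbb{R}^{d+1}$ with $\gamma\le\gamma_0$, and if the average sampling functions satisfy $\operatorname{supp}\psi_{x_j,y_k}\subseteq(x_j,y_k)+[-a,a]^{d+1}$ for some $0<a\le a_0$, then any $f\in V_{p,q}(\Phi)$ can be recovered from its average samples $\{\langle f,\psi_{x_j,y_k}\rangle:j,k\in\mathbb{J}\}$ by the iterative algorithm $$f_1=PA_Xf,\qquad f_{n+1}=PA_X(f-f_n)+f_n\quad(n\ge1).$$ In this case, the iterate $f_n$ converges to $f$ in the $L^{p,q}$-norm. Moreover, the convergence is geometric, that is, $$\|f-f_n\|_{L^{p,q}}\le C\alpha^n\quad\text{for all } n\ge1,$$ for some $\alpha=\alpha(\gamma,a,P,\Phi,M)<1$ and some $C<\infty$.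
   Context: Points of $\mathbb{R}^{d+1}$ are written $(x,y)\in\mathbb{R}\times\mathbb{R}^d$. For $1\le p,q<\infty$, $L^{p,q}=L^{p,q}(\mathbb{R}^{d+1})$ is the space of measurable functions $f$ with $$\|f\|_{L^{p,q}}=\Big[\int_{\mathbb{R}}\Big(\int_{\mathbb{R}^d}|f(x,y)|^q\,dy\Big)^{p/q}dx\Big]^{1/p}<\infty,$$ and $\ell^{p,q}=\ell^{p,q}(\mathbb{Z}^{d+1})$ is the space of sequences $c$ with $\|c\|_{\ell^{p,q}}^p=\sum_{k_1\in\mathbb{Z}}\big(\sum_{k_2\in\mathbb{Z}^d}|c(k_1,k_2)|^q\big)^{p/q}<\infty$. The mixed Wiener amalgam space $W(L^{p,q})$ consists of measurable $f$ with $$\|f\|_{W(L^{p,q})}^p=\sum_{n\in\mathbb{Z}}\sup_{x\in[0,1]}\Big[\sum_{l\in\mathbb{Z}^d}\sup_{y\in[0,1]^d}|f(x+n,y+l)|^q\Big]^{p/q}<\infty,$$ and $W_0(L^{p,q})$ is the space of all continuous functions in $W(L^{p,q})$. $(B)^{(r)}$ denotes the product of $r$ copies of a Banach space $B$. For $\Phi=(\phi_1,\dots,\phi_r)^T\in W(L^{1,1})^{(r)}$, the multiply generated shift-invariant space is $$V_{p,q}(\Phi)=\Big\{\sum_{i=1}^r\sum_{k_1\in\mathbb{Z}}\sum_{k_2\in\mathbb{Z}^d}c_i(k_1,k_2)\phi_i(\cdot-k_1,\cdot-k_2): c_i\in\ell^{p,q},\ 1\le i\le r\Big\}.$$ $\mathbb{J}$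 is a countable index set. $B_\gamma(x,y)$ is the open ball with center $(x,y)$ and radius $\gamma$. A set $X=\{(x_j,y_k):j,k\in\mathbb{J}\}$, $x_j\in\mathbb{R}$, $y_k\in\mathbb{R}^d$, is $\gamma_0$-dense in $\mathbb{R}^{d+1}$ if $\mathbb{R}^{d+1}=\bigcup_{j,k}B_\gamma(x_j,y_k)$ for every $\gamma>\gamma_0$. A bounded uniform partition of unity associated to $\{B_\gamma(x_j,y_k):j,k\in\mathbb{J}\}$ is a set of functions $\{\beta_{j,k}:j,k\in\mathbb{J}\}$ with $0\le\beta_{j,k}\le1$, $\operatorname{supp}\beta_{j,k}\subset B_\gamma(x_j,y_k)$, and $\sum_{j\in\mathbb{J}}\sum_{k\in\mathbb{J}}\beta_{j,k}=1$. Put $\langle f,g\rangle=\int_{\mathbb{R}^{d+1}}f\,\overline{g}$. Given a $\gamma$-dense set $X$ and a bounded uniform partition of unity $\{\beta_{j,k}\}$ associated to $\{B_\gamma(x_j,y_k)\}$, define $$A_Xf=\sum_{j\in\mathbb{J}}\sum_{k\in\mathbb{J}}\langle f,\psi_{x_j,y_k}\rangle\,\beta_{j,k}.$$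
   Formalization: The density γ0 and the bound a0 may depend on P (and on p, q) as well as on Φ and M: independence of P fails, since adding to P a large multiple of ⟨·,h⟩f with h annihilating V and f in V makes the iteration diverge. The functions β_{j,k} are taken measurable. *)

theory Defs
  imports "HOL-Analysis.Analysis"
begin

text \<open>
  Points of \<open>\<real>\<close>-by-\<open>d\<close>-dimensional space are pairs in \<^typ>\<open>real \<times> (real^'d)\<close> (with the
  Euclidean distance of the product), \<open>d\<close> being the cardinality of \<^typ>\<open>'d\<close>.
  Functions are complex valued and measurable means Lebesgue measurable. An element of
  \<open>L\<^bsup>p,q\<^esup>\<close> is represented by any function in its class, so that identities between elements of
  \<open>L\<^bsup>p,q\<^esup>\<close> become identities almost everywhere. Norms take values in \<^typ>\<open>ennreal\<close>, so they are
  infinite, not junk, outside the corresponding space.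
\<close>

type_synonym 'd cfun = "real \<times> (real^'d) \<Rightarrow> complex"

text \<open>Powers of extended nonnegative reals, for exponents \<open>s > 0\<close> only.\<close>

definition epowr :: "ennreal \<Rightarrow> real \<Rightarrow> ennreal" where
  "epowr t s = (if t = \<infinity> then \<infinity> else ennreal (enn2real t powr s))"

definition int_vec :: "int^'d \<Rightarrow> real^'d" where
  "int_vec l = (\<chi> i. of_int (l $ i))"

definition Lpq_norm :: "real \<Rightarrow> real \<Rightarrow> 'd::finite cfun \<Rightarrow> ennreal" where
  "Lpq_norm p q f =
     epowr (\<integral>\<^sup>+ x. epowr (\<integral>\<^sup>+ y. ennreal (norm (f (x, y)) powr q) \<partial>lebesgue) (p / q) \<partial>lebesgue) (1 / p)"

definition Lpq :: "real \<Rightarrow> real \<Rightarrow> 'd::finite cfun set" where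
  "Lpq p q = {f. f \<in> borel_measurable lebesgue \<and> Lpq_norm p q f < \<infinity>}"

definition lpq_norm :: "real \<Rightarrow> real \<Rightarrow> (int \<times> (int^'d) \<Rightarrow> complex) \<Rightarrow> ennreal" where
  "lpq_norm p q c =
     epowr (\<Sum>\<^sub>\<infinity>k\<in>UNIV. epowr (\<Sum>\<^sub>\<infinity>l\<in>UNIV. ennreal (norm (c (k, l)) powr q)) (p / q)) (1 / p)"

definition lpq :: "real \<Rightarrow> real \<Rightarrow> (int \<times> (int^'d) \<Rightarrow> complex) set" where
  "lpq p q = {c. lpq_norm p q c < \<infinity>}"

definition wiener_norm :: "real \<Rightarrow> real \<Rightarrow> 'd::finite cfun \<Rightarrow> ennreal" where
  "wiener_norm p q f =
     epowr (\<Sum>\<^sub>\<infinity>n\<in>UNIV. SUP x\<in>{0..1}.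
              epowr (\<Sum>\<^sub>\<infinity>l\<in>UNIV. SUP y\<in>cbox 0 One.
                       ennreal (norm (f (x + of_int n, y + int_vec l)) powr q)) (p / q)) (1 / p)"

definition wiener :: "real \<Rightarrow> real \<Rightarrow> 'd::finite cfun set" where
  "wiener p q = {f. f \<in> borel_measurable lebesgue \<and> wiener_norm p q f < \<infinity>}"

definition wiener0 :: "real \<Rightarrow> real \<Rightarrow> 'd::finite cfun set" where
  "wiener0 p q = {f \<in> wiener p q. continuous_on UNIV f}"

definition supp :: "('a::topological_space \<Rightarrow> 'b::zero) \<Rightarrow> 'a set" where
  "supp f = closure {z. f z \<noteq> 0}"

text \<open>
  For \<open>\<Phi>\<close> in \<open>W(L\<^bsup>1,1\<^esup>)\<close> and coefficients in \<open>\<ell>\<^bsup>p,q\<^esup>\<close> the series converges absolutely at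
  every point, so it may be summed over pairs, unordered and pointwise. The space contains all
  representatives of its elements.
\<close>

definition shift_inv_space ::
  "real \<Rightarrow> real \<Rightarrow> nat \<Rightarrow> (nat \<Rightarrow> 'd::finite cfun) \<Rightarrow> 'd cfun set" where
  "shift_inv_space p q r \<Phi> =
     {f. f \<in> borel_measurable lebesgue \<and>
         (\<exists>c. (\<forall>i\<in>{1..r}. c i \<in> lpq p q) \<and>
              (AE z in lebesgue. f z =
                 (\<Sum>i=1..r. \<Sum>\<^sub>\<infinity>(k, l)\<in>UNIV. c i (k, l) * \<Phi> i (fst z - of_int k, snd z - int_vec l))))}"

text \<open>
  The operator acts on representatives; its values outside \<open>L\<^bsup>p,q\<^esup>\<close> are irrelevant.
  Linearity and boundedness make it compatible with equality almost everywhere.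
\<close>

definition bounded_projection_onto ::
  "real \<Rightarrow> real \<Rightarrow> ('d::finite cfun \<Rightarrow> 'd cfun) \<Rightarrow> 'd cfun set \<Rightarrow> bool" where
  "bounded_projection_onto p q P V \<longleftrightarrow>
     (\<forall>f\<in>Lpq p q. P f \<in> Lpq p q) \<and>
     (\<forall>f\<in>Lpq p q. \<forall>g\<in>Lpq p q. AE z in lebesgue. P (\<lambda>w. f w + g w) z = P f z + P g z) \<and>
     (\<forall>f\<in>Lpq p q. \<forall>s::complex. AE z in lebesgue. P (\<lambda>w. s * f w) z = s * P f z) \<and>
     (\<exists>B::real. \<forall>f\<in>Lpq p q. Lpq_norm p q (P f) \<le> ennreal B * Lpq_norm p q f) \<and>
     (\<forall>f\<in>Lpq p q. AE z in lebesgue. P (P f) z = P f z) \<and>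
     (\<forall>f\<in>Lpq p q. P f \<in> V) \<and>
     (\<forall>v\<in>V. \<exists>f\<in>Lpq p q. AE z in lebesgue. P f z = v z)"

definition pairing :: "'d::finite cfun \<Rightarrow> 'd cfun \<Rightarrow> complex" where
  "pairing f g = (LINT z|lebesgue. f z * cnj (g z))"

text \<open>
  The countable index set is taken to be a set \<open>J\<close> of natural numbers, which up to relabelling
  covers every (finite or infinite) countable set.
\<close>

definition dense_samples :: "nat set \<Rightarrow> (nat \<Rightarrow> real) \<Rightarrow> (nat \<Rightarrow> real^'d::finite) \<Rightarrow> real \<Rightarrow> bool" where
  "dense_samples J x y \<gamma>0 \<longleftrightarrow> (\<forall>\<gamma>>\<gamma>0. (\<Union>j\<in>J. \<Union>k\<in>J. ball (x j, y k) \<gamma>) = UNIV)"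

text \<open>
  Measurability of the \<open>\<beta> j k\<close> is implicit in the usual notion; without it the approximants
  \<open>A\<^sub>X f\<close> need not be measurable. The terms are nonnegative, so the unordered sum over pairs
  is the iterated one.
\<close>

definition bupu ::
  "nat set \<Rightarrow> (nat \<Rightarrow> real) \<Rightarrow> (nat \<Rightarrow> real^'d::finite) \<Rightarrow> real \<Rightarrow>
   (nat \<Rightarrow> nat \<Rightarrow> real \<times> (real^'d) \<Rightarrow> real) \<Rightarrow> bool" where
  "bupu J x y \<gamma> \<beta> \<longleftrightarrow>
     (\<forall>j\<in>J. \<forall>k\<in>J. \<beta> j k \<in> borel_measurable lebesgue \<and>
        (\<forall>z. 0 \<le> \<beta> j k z \<and> \<beta> j k z \<le> 1) \<and> supp (\<beta> j k) \<subseteq> ball (x j, y k) \<gamma>) \<and>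
     (\<forall>z. ((\<lambda>(j, k). \<beta> j k z) has_sum 1) (J \<times> J))"

definition averaging_functions ::
  "nat set \<Rightarrow> real \<Rightarrow> (nat \<Rightarrow> nat \<Rightarrow> 'd::finite cfun) \<Rightarrow> bool" where
  "averaging_functions J M \<psi> \<longleftrightarrow>
     (\<forall>j\<in>J. \<forall>k\<in>J. \<psi> j k \<in> wiener 1 1 \<and>
        (LINT z|lebesgue. \<psi> j k z) = 1 \<and> (LINT z|lebesgue. norm (\<psi> j k z)) \<le> M)"

definition sampling_operator ::
  "nat set \<Rightarrow> (nat \<Rightarrow> nat \<Rightarrow> 'd::finite cfun) \<Rightarrow>
   (nat \<Rightarrow> nat \<Rightarrow> real \<times> (real^'d) \<Rightarrow> real) \<Rightarrow> 'd cfun \<Rightarrow> 'd cfun" where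
  "sampling_operator J \<psi> \<beta> f =
     (\<lambda>z. \<Sum>\<^sub>\<infinity>(j, k)\<in>J \<times> J. pairing f (\<psi> j k) * of_real (\<beta> j k z))"

end

theory Submission
  imports Defs
begin

text \<open>
  For \<open>h\<close> in the shift-invariant space the projection satisfies \<open>P h = h\<close>, so
  \<open>h - P (A h) = P (h - A h)\<close>, where \<open>A\<close> is the sampling operator. Since the recursion reads
  \<open>f - F (n + 1) = h - P (A h)\<close> with \<open>h = f - F n\<close>, geometric convergence follows once
  \<open>\<parallel>h - A h\<parallel> \<le> \<epsilon> \<parallel>h\<parallel>\<close> holds with \<open>\<epsilon>\<close> at most \<open>1 / (2 * B)\<close> for a bound \<open>B > 0\<close> of \<open>P\<close>.

  For the continuous representative of \<open>h\<close>, the error \<open>\<bar>h - A h\<bar>\<close> at \<open>z\<close> is at most \<open>M\<close> times the oscillation of \<open>h\<close> on a ball around \<open>z\<close> whose radius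
  \<open>\<delta>\<close> tends to 0 with \<open>\<gamma>\<close> and \<open>a\<close> (\<open>sampling_error\<close>). It remains to bound the mixed norm of this
  oscillation by a small multiple of the norm of \<open>h\<close>.

  The bound is obtained locally. Because the generators have compact support, near each lattice
  point \<open>h\<close> lies, up to translation, in one fixed finite-dimensional space of continuous functions
  (\<open>shift_series_locally_spanned\<close>). In such a space suitable coefficients are bounded by finitely many samples, and
  the sample points may be moved within small balls (\<open>finite_span_coefficients_perturbed\<close>). Uniform
  continuity of the spanning functions then bounds the oscillation near a lattice point by a small multiple
  of the values of \<open>\<bar>h\<bar>\<close> at arbitrary nearby points (\<open>oscillation_le_samples\<close>). Averaging these
  points, in the variable \<open>y\<close> inside the inner integral and in \<open>x\<close> inside the outer one, turns the
  samples into the mixed norm of \<open>h\<close> (\<open>averaging_bound\<close>, \<open>oscillation_norm_bound\<close>).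
\<close>

section \<open>Powers of extended nonnegative reals\<close>

lemma epowr_ennreal: "0 \<le> t \<Longrightarrow> epowr (ennreal t) s = ennreal (t powr s)"
  by (simp add: epowr_def)

lemma epowr_0 [simp]: "epowr 0 s = 0"
  by (simp add: epowr_def)

lemma epowr_top [simp]: "epowr top s = top"
  by (simp add: epowr_def)

lemma epowr_eq_top_iff [simp]: "epowr t s = top \<longleftrightarrow> t = top"
  by (simp add: epowr_def)

lemma epowr_less_top_iff [simp]: "epowr t s < top \<longleftrightarrow> t < top"
  by (simp add: less_top[symmetric])

lemma epowr_eq_0_iff [simp]: "epowr t s = 0 \<longleftrightarrow> t = 0"
  by (cases t) (auto simp: epowr_ennreal ennreal_eq_0_iff)

lemma epowr_mono: "0 < s \<Longrightarrow> t \<le> u \<Longrightarrow> epowr t s \<le> epowr u s"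
  by (cases t; cases u) (auto simp: epowr_ennreal top_unique intro!: powr_mono2)

lemma epowr_mult: "0 < s \<Longrightarrow> 0 \<le> c \<Longrightarrow> epowr (ennreal c * t) s = ennreal (c powr s) * epowr t s"
  by (cases t; cases "c = 0")
     (auto simp: epowr_ennreal ennreal_mult[symmetric] powr_mult ennreal_mult_top)

text \<open>
  This crude bound (the sum is at most its number of terms times the largest one) replaces
  Minkowski's inequality throughout: all sums to be estimated have a fixed number of terms.
\<close>

lemma epowr_sum_le:
  assumes "finite S" "0 < s"
  shows "epowr (\<Sum>i\<in>S. t i) s \<le> ennreal (real (card S) powr s) * (\<Sum>i\<in>S. epowr (t i) s)"
proof (cases "S = {}")
  case False
  then have "Max (t ` S) \<in> t ` S"
    using assms by (intro Max_in) auto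
  then obtain j where j: "j \<in> S" "t j = Max (t ` S)"
    by auto
  have "(\<Sum>i\<in>S. t i) \<le> (\<Sum>i\<in>S. t j)"
    using assms j by (intro sum_mono) auto
  also have "\<dots> = ennreal (card S) * t j"
    by (simp add: ennreal_of_nat_eq_real_of_nat)
  finally have "epowr (\<Sum>i\<in>S. t i) s \<le> epowr (ennreal (card S) * t j) s"
    by (intro epowr_mono assms)
  also have "\<dots> = ennreal (real (card S) powr s) * epowr (t j) s"
    using assms by (intro epowr_mult) auto
  also have "\<dots> \<le> ennreal (real (card S) powr s) * (\<Sum>i\<in>S. epowr (t i) s)"
    using assms j by (intro mult_left_mono member_le_sum) auto
  finally show ?thesis .
qed simp

lemma epowr_measurable [measurable]:
  assumes [measurable]: "f \<in> borel_measurable N"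
  shows "(\<lambda>x. epowr (f x) s) \<in> borel_measurable N"
  unfolding epowr_def by measurable

section \<open>Averaging over nearby balls\<close>

text \<open>
  A value that bounds \<open>G\<close> from below on a whole ball is at most the mean of \<open>G\<close> over that ball.
  The ball may jump with \<open>y\<close> as long as it stays within distance \<open>R\<close>, so the mean is at most
  a multiple of the integral of \<open>G\<close> over the ball of radius \<open>R\<close> around \<open>y\<close>, and Tonelli's theorem
  integrates this over \<open>y\<close>. In the application the centre of the ball is
  a fixed displacement away from the lattice point below \<open>y\<close>.
\<close>

lemma averaging_bound:
  fixes G g :: "'a::euclidean_space \<Rightarrow> ennreal" and c :: "'a \<Rightarrow> 'a"
  assumes [measurable]: "G \<in> borel_measurable borel"
    and "0 < \<rho>" "0 \<le> R"
    and near: "\<And>y. ball (c y) \<rho> \<subseteq> cball y R"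
    and le: "\<And>y y'. y' \<in> ball (c y) \<rho> \<Longrightarrow> g y \<le> G y'"
  shows "(\<integral>\<^sup>+ y. g y \<partial>lborel) \<le> ennreal ((R / \<rho>) ^ DIM('a)) * (\<integral>\<^sup>+ y. G y \<partial>lborel)"
proof -
  define u where "u = unit_ball_vol (real DIM('a))"
  have u: "0 < u" unfolding u_def by simp
  have v: "emeasure lborel (ball y \<rho>) = ennreal (u * \<rho> ^ DIM('a))"
    and V: "emeasure lborel (cball y R) = ennreal (u * R ^ DIM('a))" for y :: 'a
    using assms unfolding u_def by (simp_all add: emeasure_ball emeasure_cball)
  have "closed {p :: 'a \<times> 'a. snd p \<in> cball (fst p) R}"
    unfolding mem_cball by (intro closed_Collect_le continuous_intros)
  then have "{p :: 'a \<times> 'a. snd p \<in> cball (fst p) R} \<in> sets borel"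
    by (rule borel_closed)
  moreover have "(\<lambda>p :: 'a \<times> 'a. indicator (cball (fst p) R) (snd p) :: ennreal)
      = indicator {p. snd p \<in> cball (fst p) R}"
    by (auto simp: indicator_def)
  ultimately have [measurable]: "(\<lambda>p. indicator (cball (fst p) R) (snd p) :: ennreal)
      \<in> borel_measurable (borel \<Otimes>\<^sub>M (borel :: 'a measure))"
    by (simp only: borel_prod borel_measurable_indicator)
  have meas: "(\<lambda>(y, y'). G y' * indicator (cball y R) y')
      \<in> borel_measurable (lborel \<Otimes>\<^sub>M (lborel :: 'a measure))"
    unfolding split_beta' by measurable
  have "g y \<le> ennreal (1 / (u * \<rho> ^ DIM('a))) * (\<integral>\<^sup>+ y'. G y' * indicator (cball y R) y' \<partial>lborel)" for y
  proof -
    have "g y = ennreal (1 / (u * \<rho> ^ DIM('a))) * (g y * ennreal (u * \<rho> ^ DIM('a)))"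
      using u \<open>0 < \<rho>\<close> by (simp add: mult.left_commute flip: ennreal_mult)
    also have "g y * ennreal (u * \<rho> ^ DIM('a)) = (\<integral>\<^sup>+ y'. g y * indicator (ball (c y) \<rho>) y' \<partial>lborel)"
      by (simp add: nn_integral_cmult_indicator v)
    also have "\<dots> \<le> (\<integral>\<^sup>+ y'. G y' * indicator (cball y R) y' \<partial>lborel)"
    proof (intro nn_integral_mono)
      show "g y * indicator (ball (c y) \<rho>) y' \<le> G y' * indicator (cball y R) y'" for y'
        using near[of y] le[of y' y] by (cases "y' \<in> ball (c y) \<rho>") auto
    qed
    finally show ?thesis by (simp add: mult_left_mono)
  qed
  then have "(\<integral>\<^sup>+ y. g y \<partial>lborel) \<le> (\<integral>\<^sup>+ y. ennreal (1 / (u * \<rho> ^ DIM('a))) *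
      (\<integral>\<^sup>+ y'. G y' * indicator (cball y R) y' \<partial>lborel) \<partial>lborel)"
    by (rule nn_integral_mono)
  also have "\<dots> = ennreal (1 / (u * \<rho> ^ DIM('a))) *
      (\<integral>\<^sup>+ y. \<integral>\<^sup>+ y'. G y' * indicator (cball y R) y' \<partial>lborel \<partial>lborel)"
    by (intro nn_integral_cmult lborel.borel_measurable_nn_integral meas)
  also have "(\<integral>\<^sup>+ y. \<integral>\<^sup>+ y'. G y' * indicator (cball y R) y' \<partial>lborel \<partial>lborel)
      = (\<integral>\<^sup>+ y'. \<integral>\<^sup>+ y. G y' * indicator (cball y R) y' \<partial>lborel \<partial>lborel)"
    by (rule lborel_pair.Fubini'[symmetric, OF meas])
  also have "\<dots> = (\<integral>\<^sup>+ y'. G y' * ennreal (u * R ^ DIM('a)) \<partial>lborel)"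
  proof (intro nn_integral_cong)
    fix y' :: 'a
    have "(\<integral>\<^sup>+ y. G y' * indicator (cball y R) y' \<partial>lborel)
        = (\<integral>\<^sup>+ y. G y' * indicator (cball y' R) y \<partial>lborel)"
      by (intro nn_integral_cong) (auto simp: indicator_def dist_commute)
    then show "(\<integral>\<^sup>+ y. G y' * indicator (cball y R) y' \<partial>lborel) = G y' * ennreal (u * R ^ DIM('a))"
      by (simp add: nn_integral_cmult_indicator V)
  qed
  also have "\<dots> = (\<integral>\<^sup>+ y'. G y' \<partial>lborel) * ennreal (u * R ^ DIM('a))"
    by (simp add: nn_integral_multc)
  also have "ennreal (1 / (u * \<rho> ^ DIM('a))) * \<dots>
      = ennreal ((R / \<rho>) ^ DIM('a)) * (\<integral>\<^sup>+ y. G y \<partial>lborel)"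
    using u \<open>0 < \<rho>\<close> \<open>0 \<le> R\<close>
    by (simp add: mult.left_commute power_divide mult.commute[of _ "integral\<^sup>N lborel G"] flip: ennreal_mult)
  finally show ?thesis .
qed

section \<open>Mixed norms\<close>

definition slice_integral :: "real \<Rightarrow> 'd::finite cfun \<Rightarrow> real \<Rightarrow> ennreal" where
  "slice_integral q f x = (\<integral>\<^sup>+ y. epowr (ennreal (norm (f (x, y)))) q \<partial>lborel)"

lemma Lpq_norm_slice:
  "Lpq_norm p q f = epowr (\<integral>\<^sup>+ x. epowr (slice_integral q f x) (p / q) \<partial>lborel) (1 / p)"
  by (simp add: Lpq_norm_def slice_integral_def nn_integral_completion epowr_ennreal)

lemma slice_integral_measurable [measurable]:
  assumes "f \<in> borel_measurable borel"
  shows "slice_integral q f \<in> borel_measurable borel"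
proof -
  have [measurable]: "f \<in> borel_measurable (borel \<Otimes>\<^sub>M borel)"
    using assms by (simp add: borel_prod)
  show ?thesis
    unfolding slice_integral_def by measurable
qed

lemma Lpq_norm_mono_AE:
  fixes f g :: "'d::finite cfun"
  assumes "1 \<le> p" "1 \<le> q" and "AE z in lebesgue. norm (f z) \<le> norm (g z)"
  shows "Lpq_norm p q f \<le> Lpq_norm p q g"
proof -
  have "AE z in lborel \<Otimes>\<^sub>M lborel. norm (f z) \<le> norm (g z)"
    using assms(3) unfolding AE_completion_iff lborel_prod .
  then have "AE x in lborel. AE y in lborel. norm (f (x, y)) \<le> norm (g (x, y))"
    by (rule lborel_pair.AE_pair)
  then have "AE x in lborel. slice_integral q f x \<le> slice_integral q g x"
    unfolding slice_integral_def using \<open>1 \<le> q\<close>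
    by (elim AE_mp) (auto intro!: AE_I2 nn_integral_mono_AE epowr_mono elim!: eventually_mono)
  then show ?thesis
    unfolding Lpq_norm_slice using assms(1,2)
    by (intro epowr_mono nn_integral_mono_AE) (auto intro!: epowr_mono elim!: eventually_mono)
qed

lemma Lpq_norm_cong_AE:
  assumes "1 \<le> p" "1 \<le> q" and "AE z in lebesgue. f z = g z"
  shows "Lpq_norm p q f = Lpq_norm p q g"
  using assms by (intro antisym Lpq_norm_mono_AE) (auto elim: eventually_mono)

lemma Lpq_cong_AE:
  assumes "1 \<le> p" "1 \<le> q" and "AE z in lebesgue. f z = g z"
    and "f \<in> Lpq p q" "g \<in> borel_measurable lebesgue"
  shows "g \<in> Lpq p q"
  using assms Lpq_norm_cong_AE[OF assms(1-3)] by (simp add: Lpq_def)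

text \<open>
  Slices of a Lebesgue measurable function need not be measurable, and then their integrals are not
  additive. Additivity and definiteness of the mixed norm are therefore proved for
  Borel representatives, all of whose slices are measurable.
\<close>

lemma borel_representative:
  fixes f :: "'a::euclidean_space \<Rightarrow> complex"
  assumes f: "f \<in> borel_measurable lebesgue"
  obtains f' where "f' \<in> borel_measurable borel" "AE z in lebesgue. f z = f' z"
proof -
  have "(\<lambda>z. Re (f z)) \<in> borel_measurable lebesgue" "(\<lambda>z. Im (f z)) \<in> borel_measurable lebesgue"
    using f by simp_all
  then obtain g h where gh: "g \<in> borel_measurable lborel" "AE z in lborel. Re (f z) = g z"
      "h \<in> borel_measurable lborel" "AE z in lborel. Im (f z) = h z"
    by (metis completion_ex_borel_measurable_real)
  show ?thesis
  proof
    show "(\<lambda>z. Complex (g z) (h z)) \<in> borel_measurable borel"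
      using gh unfolding borel_measurable_complex_iff by simp
    show "AE z in lebesgue. f z = Complex (g z) (h z)"
      using gh(2,4) unfolding AE_completion_iff by eventually_elim (simp add: complex_eq_iff)
  qed
qed

text \<open>
  The inequality \<open>(s + t) powr a \<le> 2 powr a * (s powr a + t powr a)\<close> is applied once in the inner
  and once in the outer integral. This gives finiteness only, with a worse constant than Minkowski's inequality.
\<close>

lemma Lpq_add:
  fixes f g :: "'d::finite cfun"
  assumes p: "1 \<le> p" and q: "1 \<le> q" and f: "f \<in> Lpq p q" and g: "g \<in> Lpq p q"
  shows "(\<lambda>z. f z + g z) \<in> Lpq p q"
proof -
  have "f \<in> borel_measurable lebesgue" "g \<in> borel_measurable lebesgue"
    using f g by (simp_all add: Lpq_def)
  from this(1) obtain f' where f': "f' \<in> borel_measurable borel" "AE z in lebesgue. f z = f' z"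
    by (rule borel_representative)
  from \<open>g \<in> borel_measurable lebesgue\<close>
  obtain g' where g': "g' \<in> borel_measurable borel" "AE z in lebesgue. g z = g' z"
    by (rule borel_representative)
  note [measurable] = f'(1) g'(1)
  have pq: "0 < p / q" and q0: "0 < q" and p0: "0 < p" using p q by auto
  have mp [measurable]: "(\<lambda>y. f' (x, y)) \<in> borel_measurable borel"
      "(\<lambda>y. g' (x, y)) \<in> borel_measurable borel" for x
    using f'(1) g'(1) by (auto simp: borel_prod[symmetric])
  have sum2: "epowr (a + b) s \<le> ennreal (2 powr s) * (epowr a s + epowr b s)" if "0 < s" for a b s
    using epowr_sum_le[of "{False, True}" s "\<lambda>i. if i then a else b"] that by (simp add: add.commute)
  have slice: "slice_integral q (\<lambda>z. f' z + g' z) x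
      \<le> ennreal (2 powr q) * (slice_integral q f' x + slice_integral q g' x)" for x
  proof -
    have "slice_integral q (\<lambda>z. f' z + g' z) x \<le> (\<integral>\<^sup>+ y. ennreal (2 powr q) *
        (epowr (ennreal (norm (f' (x, y)))) q + epowr (ennreal (norm (g' (x, y)))) q) \<partial>lborel)"
      unfolding slice_integral_def
      by (intro nn_integral_mono order.trans[OF epowr_mono sum2])
         (auto simp: q0 norm_triangle_ineq simp flip: ennreal_plus)
    then show ?thesis
      by (simp add: slice_integral_def nn_integral_cmult nn_integral_add)
  qed
  have "(\<integral>\<^sup>+ x. epowr (slice_integral q (\<lambda>z. f' z + g' z) x) (p / q) \<partial>lborel)
      \<le> (\<integral>\<^sup>+ x. ennreal ((2 powr q) powr (p / q)) * (ennreal (2 powr (p / q)) *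
          (epowr (slice_integral q f' x) (p / q) + epowr (slice_integral q g' x) (p / q))) \<partial>lborel)"
    by (intro nn_integral_mono order.trans[OF epowr_mono[OF pq slice]])
       (simp add: epowr_mult pq sum2 mult_left_mono)
  also have "\<dots> = ennreal ((2 powr q) powr (p / q)) * (ennreal (2 powr (p / q)) *
      ((\<integral>\<^sup>+ x. epowr (slice_integral q f' x) (p / q) \<partial>lborel) +
       (\<integral>\<^sup>+ x. epowr (slice_integral q g' x) (p / q) \<partial>lborel)))"
    by (simp add: nn_integral_cmult nn_integral_add)
  also have "\<dots> < \<infinity>"
  proof -
    have "Lpq_norm p q f' < \<infinity>" "Lpq_norm p q g' < \<infinity>"
      using f g Lpq_norm_cong_AE[OF p q f'(2)] Lpq_norm_cong_AE[OF p q g'(2)] by (auto simp: Lpq_def)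
    then show ?thesis
      by (simp add: Lpq_norm_slice ennreal_mult_less_top)
  qed
  finally have "Lpq_norm p q (\<lambda>z. f' z + g' z) < \<infinity>"
    by (simp add: Lpq_norm_slice)
  moreover have "AE z in lebesgue. f z + g z = f' z + g' z"
    using f'(2) g'(2) by eventually_elim simp
  then have "Lpq_norm p q (\<lambda>z. f z + g z) = Lpq_norm p q (\<lambda>z. f' z + g' z)"
    by (rule Lpq_norm_cong_AE[OF p q])
  ultimately show ?thesis
    using f g by (auto simp: Lpq_def)
qed

lemma Lpq_uminus:
  assumes "f \<in> Lpq p q"
  shows "(\<lambda>z. (- 1) * f z) \<in> Lpq p q"
  using assms by (simp add: Lpq_def Lpq_norm_def)

lemma Lpq_diff:
  assumes "1 \<le> p" "1 \<le> q" "f \<in> Lpq p q" "g \<in> Lpq p q"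
  shows "(\<lambda>z. f z - g z) \<in> Lpq p q"
  using Lpq_add[OF assms(1-3) Lpq_uminus[OF assms(4)]] by simp

lemma Lpq_norm_eq_0_AE:
  fixes f :: "'d::finite cfun"
  assumes "1 \<le> p" "1 \<le> q" and f: "f \<in> borel_measurable lebesgue" and 0: "Lpq_norm p q f = 0"
  shows "AE z in lebesgue. f z = 0"
proof -
  obtain f' where f'[measurable]: "f' \<in> borel_measurable borel" and eq: "AE z in lebesgue. f z = f' z"
    using borel_representative[OF f] by blast
  have [measurable]: "(\<lambda>y. f' (x, y)) \<in> borel_measurable borel" for x
    using f' by (auto simp: borel_prod[symmetric])
  have "Lpq_norm p q f' = 0"
    using 0 Lpq_norm_cong_AE[OF assms(1,2) eq] by simp
  then have "AE x in lborel. slice_integral q f' x = 0"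
    by (simp add: Lpq_norm_slice nn_integral_0_iff_AE)
  then have "AE x in lborel. AE y in lborel. f' (x, y) = 0"
    by eventually_elim (simp add: slice_integral_def nn_integral_0_iff_AE)
  moreover have "{z \<in> space (lborel \<Otimes>\<^sub>M lborel). f' z = 0} \<in> sets (lborel \<Otimes>\<^sub>M lborel)"
    unfolding lborel_prod by simp
  ultimately have "AE z in lborel \<Otimes>\<^sub>M lborel. f' z = 0"
    by (intro lborel_pair.AE_pair_measure)
  then have "AE z in lebesgue. f' z = 0"
    unfolding AE_completion_iff lborel_prod .
  with eq show ?thesis
    by eventually_elim simp
qed

section \<open>Finite-dimensional spaces of continuous functions\<close>

text \<open>
  In a finite-dimensional space of functions, finitely many point evaluations control some choice of
  coefficients, even when the spanning functions are linearly dependent. The induction is Gaussian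
  elimination: a spanning function \<open>e j\<close> vanishing on \<open>U\<close> gets coefficient 0; otherwise pick \<open>z0\<close>
  with \<open>e j z0 \<noteq> 0\<close> and subtract multiples of \<open>e j\<close> from the other functions to make them vanish at
  \<open>z0\<close>. The value at \<open>z0\<close> then determines the coefficient of \<open>e j\<close>.
\<close>

lemma finite_span_coefficients:
  fixes e :: "'i \<Rightarrow> 'a \<Rightarrow> complex"
  assumes "finite I"
  shows "\<exists>Z K. finite Z \<and> Z \<subseteq> U \<and> 0 \<le> K \<and>
    (\<forall>c. \<exists>c'. (\<forall>u\<in>U. (\<Sum>i\<in>I. c' i * e i u) = (\<Sum>i\<in>I. c i * e i u)) \<and>
      (\<forall>i\<in>I. norm (c' i) \<le> K * (\<Sum>z\<in>Z. norm (\<Sum>i\<in>I. c i * e i z))))"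
  using assms
proof (induction I arbitrary: e rule: finite_induct)
  case empty
  show ?case by (intro exI[of _ "{}"] exI[of _ 0]) auto
next
  case (insert j I)
  show ?case
  proof (cases "\<forall>u\<in>U. e j u = 0")
    case True
    from insert.IH[of e] obtain Z K where Z: "finite Z" "Z \<subseteq> U" "0 \<le> K" and
      K: "\<And>c. \<exists>c'. (\<forall>u\<in>U. (\<Sum>i\<in>I. c' i * e i u) = (\<Sum>i\<in>I. c i * e i u)) \<and>
          (\<forall>i\<in>I. norm (c' i) \<le> K * (\<Sum>z\<in>Z. norm (\<Sum>i\<in>I. c i * e i z)))"
      by auto
    show ?thesis
    proof (rule exI[of _ Z], rule exI[of _ K], intro conjI allI Z)
      fix c
      from K[of c] obtain c' where c': "\<forall>u\<in>U. (\<Sum>i\<in>I. c' i * e i u) = (\<Sum>i\<in>I. c i * e i u)"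
        "\<forall>i\<in>I. norm (c' i) \<le> K * (\<Sum>z\<in>Z. norm (\<Sum>i\<in>I. c i * e i z))" by auto
      have sums: "(\<Sum>z\<in>Z. norm (\<Sum>i\<in>insert j I. c i * e i z)) = (\<Sum>z\<in>Z. norm (\<Sum>i\<in>I. c i * e i z))"
        using True Z(2) insert.hyps by (intro sum.cong) auto
      have upd: "(\<Sum>i\<in>I. (if i = j then 0 else c' i) * e i u) = (\<Sum>i\<in>I. c' i * e i u)" for u
        using insert.hyps by (intro sum.cong) auto
      have "0 \<le> K * (\<Sum>z\<in>Z. norm (\<Sum>i\<in>I. c i * e i z))"
        using Z(3) by (simp add: sum_nonneg)
      with c' True insert.hyps show "\<exists>c'. (\<forall>u\<in>U. (\<Sum>i\<in>insert j I. c' i * e i u) = (\<Sum>i\<in>insert j I. c i * e i u)) \<and>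
          (\<forall>i\<in>insert j I. norm (c' i) \<le> K * (\<Sum>z\<in>Z. norm (\<Sum>i\<in>insert j I. c i * e i z)))"
        unfolding sums by (intro exI[of _ "c'(j := 0)"]) (auto simp: upd)
    qed
  next
    case False
    then obtain z0 where z0: "z0 \<in> U" "e j z0 \<noteq> 0" by auto
    define t where "t = (\<lambda>u. e j u / e j z0)"
    define g where "g = (\<lambda>i u. e i u - e i z0 * t u)"
    from insert.IH[of g] obtain Z K where Z: "finite Z" "Z \<subseteq> U" "0 \<le> K" and
      K: "\<And>c. \<exists>c'. (\<forall>u\<in>U. (\<Sum>i\<in>I. c' i * g i u) = (\<Sum>i\<in>I. c i * g i u)) \<and>
          (\<forall>i\<in>I. norm (c' i) \<le> K * (\<Sum>z\<in>Z. norm (\<Sum>i\<in>I. c i * g i z)))"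
      by auto
    define A where "A = (\<Sum>z\<in>Z. norm (t z))"
    define K1 where "K1 = K * (1 + A)"
    define K2 where "K2 = (1 + (\<Sum>i\<in>I. K1 * norm (e i z0))) / norm (e j z0)"
    have A0: "0 \<le> A" unfolding A_def by (intro sum_nonneg) auto
    have K10: "0 \<le> K1" using A0 Z by (simp add: K1_def)
    have K20: "0 \<le> K2" using K10 by (auto simp: K2_def intro!: divide_nonneg_nonneg add_nonneg_nonneg sum_nonneg)
    \<comment> \<open>replacing \<open>e i\<close> by \<open>g i\<close> amounts to subtracting the multiple of \<open>t\<close> that kills the value at \<open>z0\<close>\<close>
    have gsum: "(\<Sum>i\<in>I. b i * g i u) = (\<Sum>i\<in>I. b i * e i u) - (\<Sum>i\<in>I. b i * e i z0) * t u" for b u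
      by (simp add: g_def algebra_simps sum_subtractf sum_distrib_left sum_distrib_right)
    show ?thesis
    proof (rule exI[of _ "insert z0 Z"], rule exI[of _ "K1 + K2"], intro conjI allI)
      show "finite (insert z0 Z)" "insert z0 Z \<subseteq> U" "0 \<le> K1 + K2"
        using Z z0 K10 K20 by auto
      fix c
      define f where "f = (\<lambda>u. \<Sum>i\<in>insert j I. c i * e i u)"
      define S where "S = (\<Sum>z\<in>insert z0 Z. norm (f z))"
      have f_eq: "(\<Sum>i\<in>insert j I. c i * e i u) = f u" for u
        by (simp add: f_def)
      have fI: "f u = c j * e j u + (\<Sum>i\<in>I. c i * e i u)" for u
        using insert.hyps by (simp add: f_def)
      have h: "(\<Sum>i\<in>I. c i * g i u) = f u - f z0 * t u" for u
        using z0 by (simp add: gsum fI t_def field_simps)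
      have S0: "norm (f z0) \<le> S" "(\<Sum>z\<in>Z. norm (f z)) \<le> S"
        using Z(1) unfolding S_def
        by (auto intro!: member_le_sum[of z0] sum_mono2)
      have S00: "0 \<le> S" by (rule order.trans[OF norm_ge_zero S0(1)])
      from K[of c] obtain c' where c': "\<And>u. u \<in> U \<Longrightarrow> (\<Sum>i\<in>I. c' i * g i u) = (\<Sum>i\<in>I. c i * g i u)"
        "\<And>i. i \<in> I \<Longrightarrow> norm (c' i) \<le> K * (\<Sum>z\<in>Z. norm (\<Sum>i\<in>I. c i * g i z))" by blast
      have "(\<Sum>z\<in>Z. norm (\<Sum>i\<in>I. c i * g i z)) \<le> (\<Sum>z\<in>Z. norm (f z) + S * norm (t z))"
        unfolding h using S0(1)
        by (intro sum_mono order.trans[OF norm_triangle_ineq4])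
           (auto simp: norm_mult mult_right_mono)
      also have "\<dots> \<le> S + S * A"
        using S0(2) by (simp add: A_def sum.distrib sum_distrib_left)
      finally have "(\<Sum>z\<in>Z. norm (\<Sum>i\<in>I. c i * g i z)) \<le> (1 + A) * S"
        by (simp add: algebra_simps)
      then have "K * (\<Sum>z\<in>Z. norm (\<Sum>i\<in>I. c i * g i z)) \<le> K1 * S"
        using Z(3) by (simp add: K1_def mult.assoc mult_left_mono)
      then have b1: "norm (c' i) \<le> K1 * S" if "i \<in> I" for i
        using c'(2)[OF that] by simp
      define b where "b = (f z0 - (\<Sum>i\<in>I. c' i * e i z0)) / e j z0"
      have "norm (f z0 - (\<Sum>i\<in>I. c' i * e i z0)) \<le> S + (\<Sum>i\<in>I. K1 * S * norm (e i z0))"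
        using S0(1) b1
        by (intro order.trans[OF norm_triangle_ineq4] add_mono order.trans[OF norm_sum] sum_mono)
           (auto simp: norm_mult mult_right_mono)
      also have "\<dots> = (1 + (\<Sum>i\<in>I. K1 * norm (e i z0))) * S"
        by (simp add: algebra_simps sum_distrib_left sum_distrib_right)
      finally have b2: "norm b \<le> K2 * S"
        by (simp add: b_def K2_def norm_divide divide_right_mono)
      have rep: "(\<Sum>i\<in>I. c' i * e i u) + b * e j u = f u" if "u \<in> U" for u
        using c'(1)[OF that] z0 unfolding h gsum b_def t_def by (simp add: field_simps)
      have upd: "(\<Sum>i\<in>I. (c'(j := b)) i * e i u) = (\<Sum>i\<in>I. c' i * e i u)" for u
        using insert.hyps by (intro sum.cong) auto
      have le: "x \<le> K1 * S \<or> x \<le> K2 * S \<Longrightarrow> x \<le> (K1 + K2) * S" for x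
        using K10 K20 S00 by (auto simp: distrib_right intro: order.trans)
      show "\<exists>c'. (\<forall>u\<in>U. (\<Sum>i\<in>insert j I. c' i * e i u) = (\<Sum>i\<in>insert j I. c i * e i u)) \<and>
          (\<forall>i\<in>insert j I. norm (c' i) \<le> (K1 + K2) * (\<Sum>z\<in>insert z0 Z. norm (\<Sum>i\<in>insert j I. c i * e i z)))"
        unfolding f_eq S_def[symmetric]
      proof (intro exI[of _ "c'(j := b)"] conjI ballI)
        show "(\<Sum>i\<in>insert j I. (c'(j := b)) i * e i u) = f u" if "u \<in> U" for u
          using rep[OF that] unfolding sum.insert[OF insert.hyps] upd by (simp add: add.commute)
        show "norm ((c'(j := b)) i) \<le> (K1 + K2) * S" if "i \<in> insert j I" for i
          using that b1 b2 by (intro le) auto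
      qed
    qed
  qed
qed

text \<open>
  The evaluation points may move independently within small balls: moving them changes the
  samples by at most \<open>\<eta>\<close> times the sum \<open>T\<close> of the coefficients, and for small \<open>\<eta>\<close> this error
  is absorbed into \<open>T\<close> on the left-hand side.
\<close>

lemma finite_span_coefficients_perturbed:
  fixes e :: "'i \<Rightarrow> 'a::metric_space \<Rightarrow> complex"
  assumes I: "finite I" and U: "open U" and e: "\<And>i. i \<in> I \<Longrightarrow> continuous_on U (e i)"
  obtains Z K \<rho> where "finite Z" "0 \<le> K" "0 < \<rho>" "\<And>z. z \<in> Z \<Longrightarrow> ball z \<rho> \<subseteq> U"
    "\<And>c \<zeta>. (\<And>z. z \<in> Z \<Longrightarrow> \<zeta> z \<in> ball z \<rho>) \<Longrightarrow>
      \<exists>c'. (\<forall>u\<in>U. (\<Sum>i\<in>I. c' i * e i u) = (\<Sum>i\<in>I. c i * e i u)) \<and>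
        (\<forall>i\<in>I. norm (c' i) \<le> K * (\<Sum>z\<in>Z. norm (\<Sum>i\<in>I. c i * e i (\<zeta> z))))"
proof -
  from finite_span_coefficients[OF I, of U e] obtain Z K where Z: "finite Z" "Z \<subseteq> U" "0 \<le> K" and
    K: "\<And>c. \<exists>c'. (\<forall>u\<in>U. (\<Sum>i\<in>I. c' i * e i u) = (\<Sum>i\<in>I. c i * e i u)) \<and>
          (\<forall>i\<in>I. norm (c' i) \<le> K * (\<Sum>z\<in>Z. norm (\<Sum>i\<in>I. c i * e i z)))"
    by auto
  define \<eta> where "\<eta> = 1 / (2 * (1 + card I * K * card Z))"
  have "0 < 1 + card I * K * card Z" using Z(3) by (simp add: add_pos_nonneg)
  then have \<eta>: "0 < \<eta>" "card I * K * card Z * \<eta> \<le> 1 / 2"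
    by (auto simp: \<eta>_def field_simps)
  have "\<exists>d>0. ball z d \<subseteq> U \<and> (\<forall>i\<in>I. \<forall>w\<in>ball z d. dist (e i w) (e i z) < \<eta>)" if "z \<in> Z" for z
  proof -
    have z: "z \<in> U" using that Z by auto
    have "\<forall>\<^sub>F w in nhds z. dist (e i w) (e i z) < \<eta>" if "i \<in> I" for i
      using e[OF that] z U \<eta>(1) by (auto simp: continuous_on_eq_continuous_at isCont_def
        tendsto_at_iff_tendsto_nhds dest!: tendstoD[of _ _ _ \<eta>])
    then have "\<forall>\<^sub>F w in nhds z. w \<in> U \<and> (\<forall>i\<in>I. dist (e i w) (e i z) < \<eta>)"
      using I U z by (intro eventually_conj eventually_ball_finite) (auto simp: eventually_nhds_in_open)
    then show ?thesis
      unfolding eventually_nhds_metric by (auto simp: subset_eq dist_commute)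
  qed
  then obtain d where d: "\<And>z. z \<in> Z \<Longrightarrow> 0 < d z \<and> ball z (d z) \<subseteq> U \<and>
      (\<forall>i\<in>I. \<forall>w\<in>ball z (d z). dist (e i w) (e i z) < \<eta>)"
    by metis
  define \<rho> where "\<rho> = Min (insert 1 (d ` Z))"
  have \<rho>: "0 < \<rho>" "\<And>z. z \<in> Z \<Longrightarrow> \<rho> \<le> d z"
    using Z(1) d by (auto simp: \<rho>_def)
  define m where "m = real (card I)"
  show ?thesis
  proof (rule that[of Z "2 * (m * K)" \<rho>])
    show "ball z \<rho> \<subseteq> U" if "z \<in> Z" for z
      using d[OF that] \<rho>(2)[OF that] by (meson subset_ball subset_trans)
  next
    fix c \<zeta> assume \<zeta>: "\<And>z. z \<in> Z \<Longrightarrow> \<zeta> z \<in> ball z \<rho>"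
    define f where "f = (\<lambda>u. \<Sum>i\<in>I. c i * e i u)"
    define S where "S = (\<Sum>z\<in>Z. norm (f (\<zeta> z)))"
    obtain c' where c': "\<And>u. u \<in> U \<Longrightarrow> (\<Sum>i\<in>I. c' i * e i u) = f u"
      "\<And>i. i \<in> I \<Longrightarrow> norm (c' i) \<le> K * (\<Sum>z\<in>Z. norm (f z))"
      using K[of c] unfolding f_def by blast
    define T where "T = (\<Sum>i\<in>I. norm (c' i))"
    have "norm (f z) \<le> norm (f (\<zeta> z)) + T * \<eta>" if "z \<in> Z" for z
    proof -
      have in_d: "\<zeta> z \<in> ball z (d z)"
        using \<zeta>[OF that] \<rho>(2)[OF that] by simp
      then have "z \<in> U" "\<zeta> z \<in> U" using that Z(2) d[OF that] by auto
      then have "f (\<zeta> z) - f z = (\<Sum>i\<in>I. c' i * (e i (\<zeta> z) - e i z))"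
        by (simp add: c'(1)[symmetric] algebra_simps sum_subtractf)
      also have "norm \<dots> \<le> (\<Sum>i\<in>I. norm (c' i) * \<eta>)"
      proof (intro order.trans[OF norm_sum] sum_mono)
        fix i assume "i \<in> I"
        then have "norm (e i (\<zeta> z) - e i z) \<le> \<eta>"
          using d[OF that] in_d by (auto simp: dist_norm less_imp_le)
        then show "norm (c' i * (e i (\<zeta> z) - e i z)) \<le> norm (c' i) * \<eta>"
          by (simp add: norm_mult mult_left_mono)
      qed
      finally show ?thesis
        using norm_triangle_ineq2[of "f z" "f (\<zeta> z)"] by (simp add: T_def sum_distrib_right norm_minus_commute)
    qed
    then have "(\<Sum>z\<in>Z. norm (f z)) \<le> S + card Z * (T * \<eta>)"
      unfolding S_def by (simp add: sum_mono order.trans[OF sum_mono] flip: sum.distrib sum_constant)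
    then have "K * (\<Sum>z\<in>Z. norm (f z)) \<le> K * (S + card Z * (T * \<eta>))"
      by (intro mult_left_mono Z)
    then have ci: "norm (c' i) \<le> K * (S + card Z * (T * \<eta>))" if "i \<in> I" for i
      using c'(2)[OF that] by simp
    then have "T \<le> card I * (K * (S + card Z * (T * \<eta>)))"
      unfolding T_def by (intro sum_bounded_above) auto
    also have "\<dots> = m * K * S + (card I * K * card Z * \<eta>) * T"
      by (simp add: m_def algebra_simps)
    \<comment> \<open>\<open>\<eta>\<close> was chosen so that the perturbation accounts for at most half of \<open>T\<close>\<close>
    also have "\<dots> \<le> m * K * S + 1 / 2 * T"
      using \<eta>(2) by (intro add_left_mono mult_right_mono) (auto simp: T_def sum_nonneg)
    finally have T: "T \<le> 2 * (m * K) * S" by simp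
    have "norm (c' i) \<le> 2 * (m * K) * S" if "i \<in> I" for i
      using that I T by (intro order.trans[OF member_le_sum[of i I "\<lambda>i. norm (c' i)"]]) (auto simp: T_def)
    then show "\<exists>c'. (\<forall>u\<in>U. (\<Sum>i\<in>I. c' i * e i u) = (\<Sum>i\<in>I. c i * e i u)) \<and>
        (\<forall>i\<in>I. norm (c' i) \<le> 2 * (m * K) * (\<Sum>z\<in>Z. norm (\<Sum>i\<in>I. c i * e i (\<zeta> z))))"
      using c'(1) unfolding f_def S_def by blast
  qed (use Z \<rho> m_def in auto)
qed

text \<open>
  Since the coefficients are bounded by samples, uniform continuity of the finitely many spanning
  functions makes the oscillation of \<^emph>\<open>every\<close> function in the span small relative to its samples.
  The points and the radius do not depend on \<open>\<epsilon>\<close>; only \<open>\<delta>\<close> does.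
\<close>

lemma oscillation_le_samples:
  fixes e :: "'i \<Rightarrow> 'a::euclidean_space \<Rightarrow> complex"
  assumes I: "finite I" and e: "\<And>i. i \<in> I \<Longrightarrow> continuous_on UNIV (e i)"
  obtains Z \<rho> where "finite Z" "0 < \<rho>" "\<And>z. z \<in> Z \<Longrightarrow> ball z \<rho> \<subseteq> ball 0 R"
    "\<And>\<epsilon>. 0 < \<epsilon> \<Longrightarrow> \<exists>\<delta>>0. \<forall>c \<zeta> u v. (\<forall>z\<in>Z. \<zeta> z \<in> ball z \<rho>) \<and> u \<in> ball 0 R \<and> v \<in> ball 0 R \<and> dist u v < \<delta> \<longrightarrow>
      norm ((\<Sum>i\<in>I. c i * e i u) - (\<Sum>i\<in>I. c i * e i v)) \<le> \<epsilon> * (\<Sum>z\<in>Z. norm (\<Sum>i\<in>I. c i * e i (\<zeta> z)))"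
proof -
  obtain Z K \<rho> where Z: "finite Z" "0 \<le> K" "0 < \<rho>" "\<And>z. z \<in> Z \<Longrightarrow> ball z \<rho> \<subseteq> ball (0::'a) R" and
    K: "\<And>c \<zeta>. (\<And>z. z \<in> Z \<Longrightarrow> \<zeta> z \<in> ball z \<rho>) \<Longrightarrow>
      \<exists>c'. (\<forall>u\<in>ball 0 R. (\<Sum>i\<in>I. c' i * e i u) = (\<Sum>i\<in>I. c i * e i u)) \<and>
        (\<forall>i\<in>I. norm (c' i) \<le> K * (\<Sum>z\<in>Z. norm (\<Sum>i\<in>I. c i * e i (\<zeta> z))))"
    by (rule finite_span_coefficients_perturbed[OF I open_ball[of 0 R], of e])
       (auto intro: continuous_on_subset[OF e])
  show ?thesis
  proof (rule that[of Z \<rho>])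
    fix \<epsilon> :: real assume "0 < \<epsilon>"
    define \<eta> where "\<eta> = \<epsilon> / (1 + card I * K)"
    have "0 < 1 + card I * K" using Z(2) by (simp add: add_pos_nonneg)
    then have \<eta>: "0 < \<eta>" "card I * K * \<eta> \<le> \<epsilon>"
      using \<open>0 < \<epsilon>\<close> by (auto simp: \<eta>_def field_simps)
    have "\<exists>\<delta>>0. \<forall>u\<in>cball 0 R. \<forall>v\<in>cball 0 R. dist u v < \<delta> \<longrightarrow> dist (e i u) (e i v) < \<eta>" if "i \<in> I" for i
    proof -
      have "uniformly_continuous_on (cball 0 R) (e i)"
        using that by (intro compact_uniformly_continuous continuous_on_subset[OF e]) auto
      then show ?thesis
        using \<eta>(1) unfolding uniformly_continuous_on_def by (metis dist_commute)
    qed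
    then obtain d where d: "\<And>i. i \<in> I \<Longrightarrow> 0 < d i \<and>
        (\<forall>u\<in>cball 0 R. \<forall>v\<in>cball 0 R. dist u v < d i \<longrightarrow> dist (e i u) (e i v) < \<eta>)"
      by metis
    define \<delta> where "\<delta> = Min (insert 1 (d ` I))"
    have \<delta>: "0 < \<delta>" "\<And>i. i \<in> I \<Longrightarrow> \<delta> \<le> d i"
      using I d by (auto simp: \<delta>_def)
    show "\<exists>\<delta>>0. \<forall>c \<zeta> u v. (\<forall>z\<in>Z. \<zeta> z \<in> ball z \<rho>) \<and> u \<in> ball 0 R \<and> v \<in> ball 0 R \<and> dist u v < \<delta> \<longrightarrow>
      norm ((\<Sum>i\<in>I. c i * e i u) - (\<Sum>i\<in>I. c i * e i v)) \<le> \<epsilon> * (\<Sum>z\<in>Z. norm (\<Sum>i\<in>I. c i * e i (\<zeta> z)))"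
    proof (intro exI[of _ \<delta>] conjI allI impI; (elim conjE)?)
      fix c \<zeta> and u v :: 'a
      assume \<zeta>: "\<forall>z\<in>Z. \<zeta> z \<in> ball z \<rho>" and u: "u \<in> ball 0 R" and v: "v \<in> ball 0 R"
        and uv: "dist u v < \<delta>"
      define S where "S = (\<Sum>z\<in>Z. norm (\<Sum>i\<in>I. c i * e i (\<zeta> z)))"
      have "0 \<le> S" unfolding S_def by (intro sum_nonneg) auto
      obtain c' where c': "\<And>u. u \<in> ball 0 R \<Longrightarrow> (\<Sum>i\<in>I. c' i * e i u) = (\<Sum>i\<in>I. c i * e i u)"
        "\<And>i. i \<in> I \<Longrightarrow> norm (c' i) \<le> K * S"
        using K[of \<zeta> c] \<zeta> unfolding S_def by blast
      have "(\<Sum>i\<in>I. c i * e i u) - (\<Sum>i\<in>I. c i * e i v) = (\<Sum>i\<in>I. c' i * (e i u - e i v))"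
        using u v by (simp add: c'(1)[symmetric] algebra_simps sum_subtractf)
      also have "norm \<dots> \<le> (\<Sum>i\<in>I. (K * S) * \<eta>)"
      proof (intro order.trans[OF norm_sum] sum_mono)
        fix i assume "i \<in> I"
        then have "norm (e i u - e i v) \<le> \<eta>"
          using d[of i] \<delta>(2)[of i] u v uv by (auto simp: dist_norm intro!: less_imp_le)
        then show "norm (c' i * (e i u - e i v)) \<le> (K * S) * \<eta>"
          using c'(2)[OF \<open>i \<in> I\<close>] by (auto simp: norm_mult intro!: mult_mono order.trans[OF norm_ge_zero])
      qed
      also have "\<dots> = card I * K * \<eta> * S"
        by simp
      also have "\<dots> \<le> \<epsilon> * S"
        by (intro mult_right_mono \<eta> \<open>0 \<le> S\<close>)
      finally show "norm ((\<Sum>i\<in>I. c i * e i u) - (\<Sum>i\<in>I. c i * e i v)) \<le> \<epsilon> * (\<Sum>z\<in>Z. norm (\<Sum>i\<in>I. c i * e i (\<zeta> z)))"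
        by (simp add: S_def)
    qed (use \<delta> in auto)
  qed (use Z in auto)
qed

section \<open>Locally spanned functions\<close>

definition vec_floor :: "real^'d \<Rightarrow> int^'d" where
  "vec_floor y = (\<chi> i. \<lfloor>y $ i\<rfloor>)"

definition lattice_point :: "int \<times> (int^'d) \<Rightarrow> real \<times> (real^'d)" where
  "lattice_point N = (of_int (fst N), int_vec (snd N))"

definition cell :: "real \<times> (real^'d) \<Rightarrow> int \<times> (int^'d)" where
  "cell z = (\<lfloor>fst z\<rfloor>, vec_floor (snd z))"

lemma lattice_point_add: "lattice_point (a + b) = lattice_point a + lattice_point b"
  by (simp add: lattice_point_def int_vec_def vec_eq_iff)

lemma dist_vec_floor:
  fixes y :: "real^'d::finite"
  shows "dist (int_vec (vec_floor y)) y \<le> CARD('d)"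
proof -
  have "norm (int_vec (vec_floor y) - y) \<le> (\<Sum>i\<in>UNIV. \<bar>(int_vec (vec_floor y) - y) $ i\<bar>)"
    by (rule norm_le_l1_cart)
  also have "\<dots> \<le> (\<Sum>i\<in>(UNIV::'d set). 1)"
    by (intro sum_mono) (simp add: int_vec_def vec_floor_def, linarith)
  finally show ?thesis by (simp add: dist_norm)
qed

lemma norm_diff_lattice_cell:
  fixes z :: "real \<times> (real^'d::finite)"
  shows "norm (z - lattice_point (cell z)) \<le> 1 + CARD('d)"
proof -
  have "norm (z - lattice_point (cell z)) \<le> norm (fst z - of_int \<lfloor>fst z\<rfloor>) + norm (snd z - int_vec (vec_floor (snd z)))"
    using norm_Pair_le[of "fst z - of_int \<lfloor>fst z\<rfloor>" "snd z - int_vec (vec_floor (snd z))"]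
    by (simp add: lattice_point_def cell_def minus_prod_def)
  also have "norm (fst z - of_int \<lfloor>fst z\<rfloor>) \<le> 1"
    by (simp, linarith)
  also have "norm (snd z - int_vec (vec_floor (snd z))) \<le> CARD('d)"
    using dist_vec_floor[of "snd z"] by (simp add: dist_norm norm_minus_commute)
  finally show ?thesis by simp
qed

lemma vec_floor_measurable [measurable]:
  "(vec_floor :: real^'d::finite \<Rightarrow> _) \<in> borel \<rightarrow>\<^sub>M count_space UNIV"
proof -
  have "vec_floor -` {l} \<inter> space borel \<in> sets borel" for l :: "int^'d"
  proof -
    have "vec_floor -` {l} \<inter> space borel =
        (\<Inter>i\<in>UNIV. {y :: real^'d. of_int (l $ i) \<le> y $ i} \<inter> {y. y $ i < of_int (l $ i) + 1})"
      by (auto simp: vec_floor_def vec_eq_iff floor_eq_iff)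
    also have "\<dots> \<in> sets borel"
      by (intro sets.countable_INT' sets.Int borel_closed borel_open closed_Collect_le
            open_Collect_less continuous_intros) auto
    finally show ?thesis .
  qed
  then show ?thesis
    by (subst measurable_count_space_eq2_countable) auto
qed

text \<open>
  A point is at distance at most \<open>d + 1\<close> from the lattice point of its cell. This radius leaves
  room for all points within distance 1 of it.
\<close>

definition cell_radius :: "'d itself \<Rightarrow> real" where
  "cell_radius _ = real CARD('d) + 3"

text \<open>
  On a ball around each lattice point the function is a combination of the same finitely many
  functions, translated to that point. The coefficients vary freely with the lattice point, which makes
  closure under differences immediate.
\<close>

definition locally_spanned ::
  "'i set \<Rightarrow> ('i \<Rightarrow> 'd::finite cfun) \<Rightarrow> 'd cfun \<Rightarrow> bool" where
  "locally_spanned I e g \<longleftrightarrow>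
     (\<forall>N. \<exists>c. \<forall>u\<in>ball 0 (cell_radius TYPE('d)). g (lattice_point N + u) = (\<Sum>i\<in>I. c i * e i u))"

lemma locally_spanned_diff:
  fixes g h :: "'d::finite cfun"
  assumes "locally_spanned I e g" "locally_spanned I e h"
  shows "locally_spanned I e (\<lambda>z. g z - h z)"
  unfolding locally_spanned_def
proof
  fix N
  obtain b where b: "\<forall>u\<in>ball 0 (cell_radius TYPE('d)). g (lattice_point N + u) = (\<Sum>i\<in>I. b i * e i u)"
    using assms(1) unfolding locally_spanned_def by blast
  obtain c where "\<forall>u\<in>ball 0 (cell_radius TYPE('d)). h (lattice_point N + u) = (\<Sum>i\<in>I. c i * e i u)"
    using assms(2) unfolding locally_spanned_def by blast
  with b show "\<exists>c. \<forall>u\<in>ball 0 (cell_radius TYPE('d)).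
      g (lattice_point N + u) - h (lattice_point N + u) = (\<Sum>i\<in>I. c i * e i u)"
    by (intro exI[of _ "\<lambda>i. b i - c i"]) (simp add: left_diff_distrib sum_subtractf)
qed

lemma locally_spanned_continuous:
  fixes g :: "'d::finite cfun"
  assumes e: "\<And>i. i \<in> I \<Longrightarrow> continuous_on UNIV (e i)" and g: "locally_spanned I e g"
  shows "continuous_on UNIV g"
  unfolding continuous_on_eq_continuous_at[OF open_UNIV]
proof
  fix z :: "real \<times> (real^'d)"
  define L where "L = lattice_point (cell z)"
  obtain c where c: "\<And>u. u \<in> ball 0 (cell_radius TYPE('d)) \<Longrightarrow> g (L + u) = (\<Sum>i\<in>I. c i * e i u)"
    using g unfolding locally_spanned_def L_def by blast
  have "z \<in> ball L (cell_radius TYPE('d))"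
    using norm_diff_lattice_cell[of z] by (simp add: L_def cell_radius_def dist_norm norm_minus_commute)
  then have "\<forall>\<^sub>F w in nhds z. w \<in> ball L (cell_radius TYPE('d))"
    by (intro eventually_nhds_in_open open_ball)
  then have "\<forall>\<^sub>F w in nhds z. g w = (\<Sum>i\<in>I. c i * e i (w - L))"
  proof eventually_elim
    case (elim w)
    then show ?case using c[of "w - L"] by (simp add: dist_norm norm_minus_commute)
  qed
  moreover have "continuous_on UNIV (\<lambda>w. \<Sum>i\<in>I. c i * e i (w - L))"
    by (intro continuous_on_sum continuous_on_mult continuous_on_const
          continuous_on_compose2[OF e] continuous_on_diff continuous_on_id) auto
  then have "isCont (\<lambda>w. \<Sum>i\<in>I. c i * e i (w - L)) z"
    unfolding continuous_on_eq_continuous_at[OF open_UNIV] by (rule bspec) (rule UNIV_I)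
  ultimately show "isCont g z"
    by (rule isCont_cong[THEN iffD2])
qed

text \<open>
  Quantifying over the upper bounds \<open>t\<close> expresses that \<open>\<bar>D z\<bar>\<close> is at most \<open>M\<close> times the oscillation
  of \<open>g\<close> at \<open>z\<close> without forming a supremum that may be infinite.
\<close>

definition dominated_by_oscillation :: "real \<Rightarrow> real \<Rightarrow> 'd::finite cfun \<Rightarrow> 'd cfun \<Rightarrow> bool" where
  "dominated_by_oscillation \<delta> M g D \<longleftrightarrow>
     (\<forall>z t. (\<forall>w. dist w z < \<delta> \<longrightarrow> norm (g w - g z) \<le> t) \<longrightarrow> norm (D z) \<le> M * t)"

text \<open>
  The analytic core: the oscillation of a locally spanned function has small mixed norm
  relative to the function itself. On each cell the oscillation is bounded by \<open>\<epsilon>0\<close> times a sum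
  of values \<open>w N s\<close>, the minima of \<open>\<bar>g\<bar>\<close> over small boxes around finitely many sample points \<open>s\<close>, translated to
  the lattice point \<open>N\<close>. Each \<open>w N s\<close> is thus at most \<open>\<bar>g (x', y')\<bar>\<close> for all \<open>x'\<close> and \<open>y'\<close> in two small balls,
  \<^emph>\<open>independently\<close> of each other. So \<open>y'\<close> can be averaged in the inner integral with \<open>x'\<close> held fixed, and \<open>x'\<close>
  in the outer integral afterwards, which is how the estimate passes through the mixed norm for
  all exponents.
\<close>

lemma oscillation_norm_bound:
  fixes e :: "'i \<Rightarrow> 'd::finite cfun"
  assumes p: "1 \<le> p" and q: "1 \<le> q" and "0 \<le> M" and "0 < \<epsilon>"
    and I: "finite I" and e: "\<And>i. i \<in> I \<Longrightarrow> continuous_on UNIV (e i)"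
  obtains \<delta> where "0 < \<delta>"
    "\<And>g D :: 'd cfun. locally_spanned I e g \<Longrightarrow> dominated_by_oscillation \<delta> M g D \<Longrightarrow>
       Lpq_norm p q D \<le> ennreal \<epsilon> * Lpq_norm p q g"
proof -
  define R where "R = cell_radius TYPE('d)"
  obtain Z \<rho> where Z: "finite Z" "0 < \<rho>" "\<And>s. s \<in> Z \<Longrightarrow> ball s \<rho> \<subseteq> ball 0 R" and
    osc: "\<And>\<epsilon>. 0 < \<epsilon> \<Longrightarrow> \<exists>\<delta>>0. \<forall>c \<zeta> u v. (\<forall>z\<in>Z. \<zeta> z \<in> ball z \<rho>) \<and> u \<in> ball 0 R \<and> v \<in> ball 0 R \<and> dist u v < \<delta> \<longrightarrow>
      norm ((\<Sum>i\<in>I. c i * e i u) - (\<Sum>i\<in>I. c i * e i v)) \<le> \<epsilon> * (\<Sum>z\<in>Z. norm (\<Sum>i\<in>I. c i * e i (\<zeta> z)))"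
    by (rule oscillation_le_samples[OF I, where e = e and R = R], rule e, assumption, rule that)
  define \<sigma> where "\<sigma> = \<rho> / 3"
  have \<sigma>: "0 < \<sigma>" using Z by (simp add: \<sigma>_def)
  define R' where "R' = R + (CARD('d) + 1) + \<sigma>"
  have R': "0 \<le> R'" using \<sigma> by (simp add: R'_def R_def cell_radius_def)
  define C1 where "C1 = (R' / \<sigma>) ^ DIM(real^'d)"
  define C2 where "C2 = (R' / \<sigma>) ^ DIM(real)"
  have C: "0 \<le> C1" "0 \<le> C2" using R' \<sigma> by (simp_all add: C1_def C2_def)
  define m where "m = real (card Z)"
  have m: "0 \<le> m" by (simp add: m_def)
  define A where "A = m powr (p / q) * C2 * C1 powr (p / q)"
  have A: "0 \<le> A" using C m by (simp add: A_def)
  \<comment> \<open>\<open>B\<close> is the constant that the averaging argument produces; \<open>\<epsilon>0\<close> can be fixed only after it\<close>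
  define B where "B = m * (A * m) powr (1 / p)"
  have B: "0 \<le> B" using m by (simp add: B_def)
  define \<epsilon>0 where "\<epsilon>0 = \<epsilon> / (1 + M * B)"
  have "0 < 1 + M * B" using B \<open>0 \<le> M\<close> by (simp add: add_pos_nonneg)
  then have \<epsilon>0: "0 < \<epsilon>0" "M * \<epsilon>0 * B \<le> \<epsilon>"
    using \<open>0 < \<epsilon>\<close> by (auto simp: \<epsilon>0_def field_simps)
  define K where "K = M * \<epsilon>0"
  have K: "0 \<le> K" using \<open>0 \<le> M\<close> \<epsilon>0 by (simp add: K_def)
  obtain \<delta>0 where "0 < \<delta>0" and \<delta>0: "\<And>c \<zeta> u v. (\<forall>s\<in>Z. \<zeta> s \<in> ball s \<rho>) \<Longrightarrow> u \<in> ball 0 R \<Longrightarrow> v \<in> ball 0 R \<Longrightarrow> dist u v < \<delta>0 \<Longrightarrow>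
      norm ((\<Sum>i\<in>I. c i * e i u) - (\<Sum>i\<in>I. c i * e i v)) \<le> \<epsilon>0 * (\<Sum>s\<in>Z. norm (\<Sum>i\<in>I. c i * e i (\<zeta> s)))"
    using osc[OF \<epsilon>0(1)] by blast
  have q0: "0 < q" and p0: "0 < p" and pq: "0 < p / q" using p q by auto
  show ?thesis
  \<comment> \<open>the bound 1 keeps points within distance \<open>\<delta>\<close> of a cell inside the ball on which \<open>g\<close> is a combination of the \<open>e i\<close>\<close>
  proof (rule that[of "min 1 \<delta>0"])
    show "0 < min 1 \<delta>0" using \<open>0 < \<delta>0\<close> by simp
    fix g D :: "'d cfun"
    assume g: "locally_spanned I e g"
      and dom: "dominated_by_oscillation (min 1 \<delta>0) M g D"
    have D: "norm (D z) \<le> M * t" if "\<And>w. dist w z < min 1 \<delta>0 \<Longrightarrow> norm (g w - g z) \<le> t" for z t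
      using dom that unfolding dominated_by_oscillation_def by blast
    have cont: "continuous_on UNIV g" by (rule locally_spanned_continuous[OF e g])
    then have [measurable]: "g \<in> borel_measurable borel" by (rule borel_measurable_continuous_onI)
    have [measurable]: "(\<lambda>y. g (x, y)) \<in> borel_measurable borel" for x
      by (intro borel_measurable_continuous_onI continuous_on_compose2[OF cont] continuous_intros) auto
    \<comment> \<open>products of balls of a third of the radius: small enough to lie in the ball around \<open>s\<close>, and varying independently in \<open>x\<close> and \<open>y\<close>\<close>
    define box where "box = (\<lambda>s :: real \<times> (real^'d). cball (fst s) \<sigma> \<times> cball (snd s) \<sigma>)"
    have box_ball: "box s \<subseteq> ball s \<rho>" for s
    proof
      fix z assume "z \<in> box s"
      then have "dist (fst s) (fst z) \<le> \<sigma>" "dist (snd s) (snd z) \<le> \<sigma>" by (auto simp: box_def)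
      moreover have "dist s z \<le> dist (fst s) (fst z) + dist (snd s) (snd z)"
        by (simp add: dist_prod_def sqrt_sum_squares_le_sum)
      ultimately show "z \<in> ball s \<rho>" using \<open>0 < \<rho>\<close> by (simp add: \<sigma>_def)
    qed
    have "\<exists>\<zeta>\<in>box s. \<forall>z\<in>box s. norm (g (lattice_point N + \<zeta>)) \<le> norm (g (lattice_point N + z))" for N s
      using \<sigma> unfolding box_def
      by (intro continuous_attains_inf compact_Times compact_cball continuous_on_norm
            continuous_on_compose2[OF cont] continuous_intros) auto
    then have "\<forall>N s. \<exists>\<zeta>. \<zeta> \<in> box s \<and> (\<forall>z\<in>box s. norm (g (lattice_point N + \<zeta>)) \<le> norm (g (lattice_point N + z)))"
      by (simp only: Bex_def) blast
    then obtain \<zeta> where \<zeta>: "\<And>N s. \<zeta> N s \<in> box s"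
        "\<And>N s z. z \<in> box s \<Longrightarrow> norm (g (lattice_point N + \<zeta> N s)) \<le> norm (g (lattice_point N + z))"
      unfolding choice_iff by blast
    define w where "w = (\<lambda>N s. ennreal (norm (g (lattice_point N + \<zeta> N s))))"
    have D_le: "ennreal (norm (D z)) \<le> ennreal K * (\<Sum>s\<in>Z. w (cell z) s)" for z
    proof -
      define L where "L = lattice_point (cell z)"
      obtain c where c: "\<And>u. u \<in> ball 0 R \<Longrightarrow> g (L + u) = (\<Sum>i\<in>I. c i * e i u)"
        using g unfolding locally_spanned_def L_def R_def by blast
      have zL: "norm (z - L) \<le> 1 + CARD('d)"
        unfolding L_def by (rule norm_diff_lattice_cell)
      have "norm (g v - g z) \<le> \<epsilon>0 * (\<Sum>s\<in>Z. norm (g (L + \<zeta> (cell z) s)))" if "dist v z < min 1 \<delta>0" for v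
      proof -
        have "norm (v - L) \<le> norm (z - L) + dist v z"
          using dist_triangle[of v L z] by (simp add: dist_norm norm_minus_commute)
        then have u: "v - L \<in> ball 0 R" "z - L \<in> ball 0 R"
          using that zL by (auto simp: R_def cell_radius_def)
        have in_ball: "\<zeta> (cell z) s \<in> ball s \<rho>" if "s \<in> Z" for s
          using \<zeta>(1) box_ball by blast
        moreover have "(\<Sum>s\<in>Z. norm (g (L + \<zeta> (cell z) s))) = (\<Sum>s\<in>Z. norm (\<Sum>i\<in>I. c i * e i (\<zeta> (cell z) s)))"
          using in_ball Z(3) by (intro sum.cong refl arg_cong[where f = norm] c) blast
        ultimately show ?thesis
          using \<delta>0[of "\<zeta> (cell z)" "v - L" "z - L" c] u that c[OF u(1)] c[OF u(2)] by (simp add: dist_norm)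
      qed
      then have "norm (D z) \<le> M * (\<epsilon>0 * (\<Sum>s\<in>Z. norm (g (L + \<zeta> (cell z) s))))"
        by (rule D)
      then show ?thesis
        unfolding w_def L_def[symmetric] using K
        by (simp add: K_def mult.assoc sum_nonneg ennreal_mult''[symmetric] ennreal_leI)
    qed
    \<comment> \<open>Being a function of the cells only, \<open>w\<close> is measurable in \<open>y\<close> and \<open>W\<close> in \<open>x\<close>, so their sums can be integrated termwise.\<close>
    define W where "W = (\<lambda>s n. \<integral>\<^sup>+ y. epowr (w (n, vec_floor y) s) q \<partial>lborel)"
    have [measurable]: "(\<lambda>y. epowr (w (n, vec_floor y) s) q) \<in> borel_measurable borel" for n s
      by (rule measurable_compose[OF vec_floor_measurable]) simp
    have [measurable]: "(\<lambda>x :: real. epowr (W s \<lfloor>x\<rfloor>) (p / q)) \<in> borel_measurable borel" for s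
      by (rule measurable_compose[OF measurable_real_floor]) simp
    have s_norm: "norm (fst s) \<le> R" "norm (snd s) \<le> R" if "s \<in> Z" for s
    proof -
      have "s \<in> ball 0 R" using Z(2) subsetD[OF Z(3)[OF that], of s] by simp
      then show "norm (fst s) \<le> R" "norm (snd s) \<le> R"
        using norm_fst_le[of "fst s" "snd s"] norm_snd_le[of "snd s" "fst s"] by auto
    qed
    have W_le: "W s n \<le> ennreal C1 * slice_integral q g x'"
      if s: "s \<in> Z" and x': "x' \<in> ball (of_int n + fst s) \<sigma>" for s n x'
      unfolding W_def slice_integral_def C1_def
    proof (rule averaging_bound[where c = "\<lambda>y. int_vec (vec_floor y) + snd s"])
      show "ball (int_vec (vec_floor y) + snd s) \<sigma> \<subseteq> cball y R'" for y
      proof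
        fix y' assume "y' \<in> ball (int_vec (vec_floor y) + snd s) \<sigma>"
        then have "norm (int_vec (vec_floor y) + snd s - y') < \<sigma>" by (simp add: dist_norm)
        moreover have "norm (y - y') \<le> norm (y - int_vec (vec_floor y)) + norm (snd s) + norm (int_vec (vec_floor y) + snd s - y')"
          by (rule order.trans[OF _ order.trans[OF norm_triangle_ineq add_mono[OF norm_triangle_ineq4 order_refl]]]) simp
        ultimately show "y' \<in> cball y R'"
          using dist_vec_floor[of y] s_norm(2)[OF s] by (simp add: R'_def dist_norm norm_minus_commute)
      qed
    next
      fix y y' assume y': "y' \<in> ball (int_vec (vec_floor y) + snd s) \<sigma>"
      define z where "z = (x' - of_int n, y' - int_vec (vec_floor y))"
      have "z \<in> box s"
        using x' y' by (auto simp: z_def box_def dist_norm algebra_simps)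
      moreover have "lattice_point (n, vec_floor y) + z = (x', y')"
        by (simp add: lattice_point_def z_def)
      ultimately show "epowr (w (n, vec_floor y) s) q \<le> epowr (ennreal (norm (g (x', y')))) q"
        unfolding w_def using \<zeta>(2)[of z s "(n, vec_floor y)"] by (intro epowr_mono q0 ennreal_leI) simp
    qed (use \<sigma> R' in auto)
    have slice_D: "slice_integral q D x \<le> ennreal ((K * m) powr q) * (\<Sum>s\<in>Z. W s \<lfloor>x\<rfloor>)" for x
    proof -
      have "slice_integral q D x \<le> (\<integral>\<^sup>+ y. ennreal ((K * m) powr q) *
          (\<Sum>s\<in>Z. epowr (w (\<lfloor>x\<rfloor>, vec_floor y) s) q) \<partial>lborel)"
        unfolding slice_integral_def
      proof (rule nn_integral_mono)
        fix y :: "real^'d"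
        have "epowr (ennreal (norm (D (x, y)))) q \<le> ennreal (K powr q) * epowr (\<Sum>s\<in>Z. w (\<lfloor>x\<rfloor>, vec_floor y) s) q"
          using epowr_mono[OF q0 D_le[of "(x, y)"]] by (simp add: epowr_mult q0 K cell_def)
        also have "\<dots> \<le> ennreal (K powr q) * (ennreal (m powr q) * (\<Sum>s\<in>Z. epowr (w (\<lfloor>x\<rfloor>, vec_floor y) s) q))"
          unfolding m_def by (intro mult_left_mono epowr_sum_le Z q0) auto
        finally show "epowr (ennreal (norm (D (x, y)))) q \<le> ennreal ((K * m) powr q) *
            (\<Sum>s\<in>Z. epowr (w (\<lfloor>x\<rfloor>, vec_floor y) s) q)"
          using K m by (simp add: powr_mult ennreal_mult mult.assoc)
      qed
      then show ?thesis
        by (simp add: nn_integral_cmult nn_integral_sum W_def)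
    qed
    define total where "total = (\<integral>\<^sup>+ x. epowr (slice_integral q g x) (p / q) \<partial>lborel)"
    have W_int: "(\<integral>\<^sup>+ x. epowr (W s \<lfloor>x\<rfloor>) (p / q) \<partial>(lborel :: real measure)) \<le> ennreal (C2 * C1 powr (p / q)) * total" if s: "s \<in> Z" for s
    proof -
      have "(\<integral>\<^sup>+ x. epowr (W s \<lfloor>x\<rfloor>) (p / q) \<partial>(lborel :: real measure))
          \<le> ennreal C2 * (\<integral>\<^sup>+ x. epowr (ennreal C1 * slice_integral q g x) (p / q) \<partial>lborel)"
        unfolding C2_def
      proof (rule averaging_bound[where c = "\<lambda>x :: real. of_int \<lfloor>x\<rfloor> + fst s" and \<rho> = \<sigma> and R = R'])
        show "ball (of_int \<lfloor>x\<rfloor> + fst s) \<sigma> \<subseteq> cball x R'" for x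
        proof
          fix x' assume "x' \<in> ball (of_int \<lfloor>x\<rfloor> + fst s) \<sigma>"
          then have "\<bar>of_int \<lfloor>x\<rfloor> + fst s - x'\<bar> < \<sigma>" by (simp add: dist_real_def)
          moreover have "0 \<le> x - of_int \<lfloor>x\<rfloor>" "x - of_int \<lfloor>x\<rfloor> \<le> 1" by linarith+
          moreover have "\<bar>fst s\<bar> \<le> R" "0 \<le> real CARD('d)" using s_norm(1)[OF s] by simp_all
          ultimately have "\<bar>x - x'\<bar> \<le> R'" unfolding R'_def by linarith
          then show "x' \<in> cball x R'" by (simp add: dist_real_def)
        qed
        show "epowr (W s \<lfloor>x\<rfloor>) (p / q) \<le> epowr (ennreal C1 * slice_integral q g x') (p / q)"
          if "x' \<in> ball (of_int \<lfloor>x\<rfloor> + fst s) \<sigma>" for x x'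
          by (intro epowr_mono pq W_le s that)
      qed (use \<sigma> R' in auto)
      then show ?thesis
        using C by (simp add: epowr_mult pq nn_integral_cmult total_def ennreal_mult mult.assoc)
    qed
    have "(\<integral>\<^sup>+ x. epowr (slice_integral q D x) (p / q) \<partial>lborel)
        \<le> (\<integral>\<^sup>+ x. ennreal ((K * m) powr p * m powr (p / q)) * (\<Sum>s\<in>Z. epowr (W s \<lfloor>x\<rfloor>) (p / q)) \<partial>(lborel :: real measure))"
    proof (rule nn_integral_mono)
      fix x :: real
      have "epowr (slice_integral q D x) (p / q) \<le> ennreal ((K * m) powr p) * epowr (\<Sum>s\<in>Z. W s \<lfloor>x\<rfloor>) (p / q)"
        using epowr_mono[OF pq slice_D[of x]] q0 by (simp add: epowr_mult pq powr_powr)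
      also have "\<dots> \<le> ennreal ((K * m) powr p) * (ennreal (m powr (p / q)) * (\<Sum>s\<in>Z. epowr (W s \<lfloor>x\<rfloor>) (p / q)))"
        unfolding m_def by (intro mult_left_mono epowr_sum_le Z pq) auto
      finally show "epowr (slice_integral q D x) (p / q)
          \<le> ennreal ((K * m) powr p * m powr (p / q)) * (\<Sum>s\<in>Z. epowr (W s \<lfloor>x\<rfloor>) (p / q))"
        by (simp add: ennreal_mult mult.assoc)
    qed
    also have "\<dots> = ennreal ((K * m) powr p * m powr (p / q)) * (\<Sum>s\<in>Z. \<integral>\<^sup>+ x. epowr (W s \<lfloor>x\<rfloor>) (p / q) \<partial>(lborel :: real measure))"
      by (simp add: nn_integral_cmult nn_integral_sum)
    also have "\<dots> \<le> ennreal ((K * m) powr p * m powr (p / q)) * (\<Sum>s\<in>Z. ennreal (C2 * C1 powr (p / q)) * total)"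
      by (intro mult_left_mono sum_mono W_int) auto
    also have "\<dots> = ennreal ((K * m) powr p * A * m) * total"
      using m C K by (simp add: A_def m_def[symmetric] ennreal_of_nat_eq_real_of_nat ennreal_mult mult_ac)
    finally have "(\<integral>\<^sup>+ x. epowr (slice_integral q D x) (p / q) \<partial>lborel) \<le> ennreal ((K * m) powr p * A * m) * total" .
    then have "Lpq_norm p q D \<le> epowr (ennreal ((K * m) powr p * A * m) * total) (1 / p)"
      unfolding Lpq_norm_slice using p0 by (intro epowr_mono) auto
    also have "\<dots> = ennreal (K * m * (A * m) powr (1 / p)) * Lpq_norm p q g"
      unfolding Lpq_norm_slice total_def using p0 K m A
      by (simp add: epowr_mult powr_mult powr_powr mult.assoc)
    finally show "Lpq_norm p q D \<le> ennreal \<epsilon> * Lpq_norm p q g"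
      using \<epsilon>0(2) by (auto simp: K_def B_def mult.assoc intro!: mult_right_mono ennreal_leI elim!: order.trans)
  qed
qed

section \<open>Shift-invariant spaces with compactly supported generators\<close>

lemma finite_bounded_lattice:
  "finite {k :: int \<times> (int^'d::finite). norm (lattice_point k) \<le> b}"
proof -
  define S where "S = {- \<lceil>b\<rceil>..\<lceil>b\<rceil>}"
  have finite_S: "finite S" by (simp add: S_def)
  have int_in: "n \<in> S" if "\<bar>of_int n\<bar> \<le> b" for n :: int
    using that unfolding S_def by (simp, linarith)
  have "vec_nth ` {l :: int^'d. \<forall>i. l $ i \<in> S} \<subseteq> PiE UNIV (\<lambda>_. S)"
    by auto
  then have "finite (vec_nth ` {l :: int^'d. \<forall>i. l $ i \<in> S})"
    by (rule finite_subset) (simp add: finite_PiE S_def)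
  then have fin: "finite {l :: int^'d. \<forall>i. l $ i \<in> S}"
    by (rule finite_imageD) (simp add: inj_on_def vec_nth_inject)
  have "{k :: int \<times> (int^'d). norm (lattice_point k) \<le> b} \<subseteq> S \<times> {l. \<forall>i. l $ i \<in> S}"
  proof
    fix k :: "int \<times> (int^'d)" assume "k \<in> {k. norm (lattice_point k) \<le> b}"
    then obtain n l where k: "k = (n, l)" and b: "norm (lattice_point (n, l)) \<le> b"
      by (cases k) auto
    have "\<bar>of_int n\<bar> \<le> norm (lattice_point (n, l))"
      using norm_fst_le[of "of_int n :: real" "int_vec l"] by (simp add: lattice_point_def)
    with b have n: "n \<in> S" by (intro int_in) simp
    have "l $ i \<in> S" for i
    proof -
      have "\<bar>int_vec l $ i\<bar> \<le> norm (int_vec l)"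
        by (rule component_le_norm_cart)
      also have "\<dots> \<le> norm (lattice_point (n, l))"
        using norm_snd_le[of "int_vec l" "of_int n :: real"] by (simp add: lattice_point_def)
      finally show ?thesis using b by (intro int_in) (simp add: int_vec_def)
    qed
    with n show "k \<in> S \<times> {l. \<forall>i. l $ i \<in> S}" by (simp add: k)
  qed
  then show ?thesis
    by (rule finite_subset) (simp add: fin finite_S)
qed

text \<open>
  Compact supports make the series locally finite: near the lattice point \<open>N\<close> only the shifts by
  \<open>N + k\<close> with \<open>k\<close> in a fixed finite set \<open>\<Lambda>\<close> contribute, and after translation by \<open>N\<close> they become the
  shifts by \<open>k\<close>.
\<close>

lemma shift_series_locally_spanned:
  fixes \<Phi> :: "nat \<Rightarrow> 'd::finite cfun"
  assumes "\<And>i. i \<in> {1..r} \<Longrightarrow> compact (supp (\<Phi> i))"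
  obtains \<Lambda> where "finite \<Lambda>"
    "\<And>c. locally_spanned ({1..r} \<times> \<Lambda>) (\<lambda>(i, k) u. \<Phi> i (u - lattice_point k))
      (\<lambda>z. \<Sum>i=1..r. \<Sum>\<^sub>\<infinity>(k, l)\<in>UNIV. c i (k, l) * \<Phi> i (fst z - of_int k, snd z - int_vec l))"
proof -
  define R where "R = cell_radius TYPE('d)"
  have "bounded (\<Union>i\<in>{1..r}. supp (\<Phi> i))"
    using assms by (intro bounded_UN) (auto intro: compact_imp_bounded)
  then obtain T where T: "\<And>z i. i \<in> {1..r} \<Longrightarrow> z \<in> supp (\<Phi> i) \<Longrightarrow> norm z \<le> T"
    unfolding bounded_iff by blast
  have zero: "\<Phi> i z = 0" if "i \<in> {1..r}" "T < norm z" for i z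
    using T[OF that(1), of z] that(2) closure_subset[of "{z. \<Phi> i z \<noteq> 0}"] unfolding supp_def by fastforce
  define \<Lambda> where "\<Lambda> = {k :: int \<times> (int^'d). norm (lattice_point k) \<le> R + T}"
  have fin: "finite \<Lambda>" unfolding \<Lambda>_def by (rule finite_bounded_lattice)
  show ?thesis
  proof (rule that[OF fin])
    fix c :: "nat \<Rightarrow> int \<times> (int^'d) \<Rightarrow> complex"
    define g where "g = (\<lambda>z. \<Sum>i=1..r. \<Sum>\<^sub>\<infinity>(k, l)\<in>UNIV. c i (k, l) * \<Phi> i (fst z - of_int k, snd z - int_vec l))"
    have "g (lattice_point N + u) =
        (\<Sum>j\<in>{1..r} \<times> \<Lambda>. (case j of (i, k) \<Rightarrow> c i (N + k)) * (case j of (i, k) \<Rightarrow> \<lambda>u. \<Phi> i (u - lattice_point k)) u)"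
      if u: "u \<in> ball 0 R" for N u
    proof -
      have "(\<Sum>\<^sub>\<infinity>(k, l)\<in>UNIV. c i (k, l) * \<Phi> i (fst (lattice_point N + u) - of_int k, snd (lattice_point N + u) - int_vec l))
          = (\<Sum>k\<in>\<Lambda>. c i (N + k) * \<Phi> i (u - lattice_point k))" if i: "i \<in> {1..r}" for i
      proof -
        have "(\<Sum>\<^sub>\<infinity>(k, l)\<in>UNIV. c i (k, l) * \<Phi> i (fst (lattice_point N + u) - of_int k, snd (lattice_point N + u) - int_vec l))
            = (\<Sum>\<^sub>\<infinity>m\<in>UNIV. c i m * \<Phi> i (lattice_point N + u - lattice_point m))"
          by (intro infsum_cong) (auto simp: lattice_point_def minus_prod_def)
        also have "\<dots> = (\<Sum>\<^sub>\<infinity>m\<in>(+) N ` \<Lambda>. c i m * \<Phi> i (lattice_point N + u - lattice_point m))"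
        proof (rule infsum_cong_neutral)
          fix m assume m: "m \<in> UNIV - (+) N ` \<Lambda>"
          have "m - N \<notin> \<Lambda>"
          proof
            assume "m - N \<in> \<Lambda>"
            then have "N + (m - N) \<in> (+) N ` \<Lambda>" by (rule imageI)
            with m show False by simp
          qed
          then have "R + T < norm (lattice_point (m - N))" by (simp add: \<Lambda>_def)
          moreover have eq: "lattice_point N + u - lattice_point m = u - lattice_point (m - N)"
            using lattice_point_add[of N "m - N"] by (simp add: algebra_simps)
          moreover have "norm (lattice_point (m - N)) - norm u \<le> norm (u - lattice_point (m - N))"
            using norm_triangle_ineq2[of "lattice_point (m - N)" u] by (simp add: norm_minus_commute)
          ultimately have "T < norm (lattice_point N + u - lattice_point m)"
            unfolding eq using u by simp
          then show "c i m * \<Phi> i (lattice_point N + u - lattice_point m) = 0"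
            by (simp add: zero[OF i])
        qed auto
        also have "\<dots> = (\<Sum>m\<in>(+) N ` \<Lambda>. c i m * \<Phi> i (lattice_point N + u - lattice_point m))"
          using fin by simp
        also have "\<dots> = (\<Sum>k\<in>\<Lambda>. c i (N + k) * \<Phi> i (u - lattice_point k))"
          by (simp add: sum.reindex lattice_point_add)
        finally show ?thesis .
      qed
      then show ?thesis
        unfolding g_def by (simp add: sum.cartesian_product split_beta')
    qed
    then show "locally_spanned ({1..r} \<times> \<Lambda>) (\<lambda>(i, k) u. \<Phi> i (u - lattice_point k)) g"
      unfolding locally_spanned_def R_def by blast
  qed
qed

section \<open>The sampling operator\<close>

lemma cnj_measurable [measurable]:
  assumes "f \<in> borel_measurable N"
  shows "(\<lambda>z. cnj (f z)) \<in> borel_measurable N"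
  by (rule measurable_compose[OF assms borel_measurable_continuous_onI]) (intro continuous_intros)

text \<open>
  As \<open>\<psi>\<close> has integral 1, the difference \<open>pairing g \<psi> - b\<close> is the integral of \<open>g - b\<close> against the
  conjugate of \<open>\<psi>\<close>, and only the values of \<open>g - b\<close> where \<open>\<psi>\<close> does not vanish matter.
\<close>

lemma pairing_error:
  fixes g \<psi> :: "'d::finite cfun"
  assumes g: "continuous_on UNIV g" and \<psi>: "(LINT z|lebesgue. \<psi> z) = 1" "(LINT z|lebesgue. norm (\<psi> z)) \<le> M"
    and near: "\<And>w. \<psi> w \<noteq> 0 \<Longrightarrow> norm (g w - b) \<le> t"
  shows "norm (pairing g \<psi> - b) \<le> M * t"
proof -
  have int: "integrable lebesgue \<psi>"
    using \<psi>(1) by (rule contrapos_pp) (simp add: not_integrable_integral_eq)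
  have "\<exists>w. \<psi> w \<noteq> 0"
  proof (rule ccontr)
    assume "\<not> ?thesis"
    then have "\<psi> = (\<lambda>z. 0)" by auto
    then have "(LINT z|lebesgue. \<psi> z) = 0" by simp
    with \<psi>(1) show False by simp
  qed
  then have "0 \<le> t" using near norm_ge_zero order.trans by blast
  have [measurable]: "g \<in> borel_measurable lebesgue"
    using borel_measurable_continuous_onI[OF g] by (intro measurable_completion) simp
  have [measurable]: "\<psi> \<in> borel_measurable lebesgue" using int by auto
  have bound: "norm ((g w - b) * cnj (\<psi> w)) \<le> t * norm (\<psi> w)" for w
    using near[of w] by (cases "\<psi> w = 0") (auto simp: norm_mult mult_right_mono)
  have int_t: "integrable lebesgue (\<lambda>w. t * norm (\<psi> w))"
    using int by (intro integrable_mult_right integrable_norm)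
  have int1: "integrable lebesgue (\<lambda>w. (g w - b) * cnj (\<psi> w))"
    using bound \<open>0 \<le> t\<close> by (intro Bochner_Integration.integrable_bound[OF int_t]) auto
  have int2: "integrable lebesgue (\<lambda>w. b * cnj (\<psi> w))"
    using int by simp
  have "pairing g \<psi> = (LINT w|lebesgue. (g w - b) * cnj (\<psi> w) + b * cnj (\<psi> w))"
    by (simp add: pairing_def algebra_simps)
  also have "\<dots> = (LINT w|lebesgue. (g w - b) * cnj (\<psi> w)) + (LINT w|lebesgue. b * cnj (\<psi> w))"
    by (rule Bochner_Integration.integral_add[OF int1 int2])
  also have "(LINT w|lebesgue. b * cnj (\<psi> w)) = b"
    using \<psi>(1) by simp
  finally have "norm (pairing g \<psi> - b) = norm (LINT w|lebesgue. (g w - b) * cnj (\<psi> w))"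
    by simp
  also have "\<dots> \<le> (LINT w|lebesgue. t * norm (\<psi> w))"
    by (rule order.trans[OF integral_norm_bound integral_mono[OF integrable_norm[OF int1] int_t bound]])
  also have "\<dots> \<le> M * t"
    using mult_left_mono[OF \<psi>(2) \<open>0 \<le> t\<close>] by (simp add: mult.commute)
  finally show ?thesis .
qed

lemma dist_cbox_center:
  fixes c w :: "'a::euclidean_space"
  assumes "w \<in> cbox (c - a *\<^sub>R One) (c + a *\<^sub>R One)"
  shows "dist w c \<le> a * DIM('a)"
proof -
  have "norm (w - c) \<le> (\<Sum>b\<in>Basis. \<bar>(w - c) \<bullet> b\<bar>)"
    by (rule norm_le_l1)
  also have "\<dots> \<le> (\<Sum>b\<in>(Basis::'a set). a)"
    using assms by (intro sum_mono) (auto simp: mem_box inner_diff_left inner_add_left abs_le_iff algebra_simps)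
  finally show ?thesis by (simp add: dist_norm mult.commute)
qed

text \<open>
  At \<open>z\<close> only the \<open>\<beta> j k\<close> with centre within \<open>\<gamma>\<close> of \<open>z\<close> contribute, and the corresponding averages see
  only values of \<open>g\<close> within distance \<open>\<delta>\<close> of \<open>z\<close>. Since the \<open>\<beta> j k\<close> sum to 1, the error is a convex
  combination of the errors of these averages.
\<close>

lemma sampling_error:
  fixes g :: "'d::finite cfun"
  assumes \<beta>: "bupu J x y \<gamma> \<beta>" and \<psi>: "averaging_functions J M \<psi>"
    and supp: "\<forall>j\<in>J. \<forall>k\<in>J. supp (\<psi> j k) \<subseteq> cbox ((x j, y k) - a *\<^sub>R One) ((x j, y k) + a *\<^sub>R One)"
    and \<delta>: "\<gamma> + a * DIM(real \<times> (real^'d)) \<le> \<delta>"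
    and g: "continuous_on UNIV g" and osc: "\<And>w. dist w z < \<delta> \<Longrightarrow> norm (g w - g z) \<le> t"
  shows "(\<lambda>(j, k). pairing g (\<psi> j k) * of_real (\<beta> j k z)) summable_on J \<times> J"
    and "norm (g z - sampling_operator J \<psi> \<beta> g z) \<le> M * t"
proof -
  define d where "d = (\<lambda>(j, k). (pairing g (\<psi> j k) - g z) * of_real (\<beta> j k z))"
  have d_le: "norm (d jk) \<le> M * t * (case jk of (j, k) \<Rightarrow> \<beta> j k z)" if "jk \<in> J \<times> J" for jk
  proof -
    obtain j k where jk: "jk = (j, k)" "j \<in> J" "k \<in> J" using \<open>jk \<in> J \<times> J\<close> by auto
    have \<beta>0: "0 \<le> \<beta> j k z" using \<beta> jk unfolding bupu_def by blast
    show ?thesis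
    proof (cases "\<beta> j k z = 0")
      case False
      then have "z \<in> supp (\<beta> j k)"
        unfolding supp_def using closure_subset[of "{z. \<beta> j k z \<noteq> 0}"] by blast
      then have zb: "dist (x j, y k) z < \<gamma>"
        using \<beta> jk unfolding bupu_def by fastforce
      have "norm (pairing g (\<psi> j k) - g z) \<le> M * t"
      proof (rule pairing_error[OF g])
        show "(LINT z|lebesgue. \<psi> j k z) = 1" "(LINT z|lebesgue. norm (\<psi> j k z)) \<le> M"
          using \<psi> jk unfolding averaging_functions_def by auto
        fix w assume "\<psi> j k w \<noteq> 0"
        then have "w \<in> supp (\<psi> j k)"
          unfolding supp_def using closure_subset[of "{w. \<psi> j k w \<noteq> 0}"] by blast
        then have "dist w (x j, y k) \<le> a * DIM(real \<times> (real^'d))"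
          using supp jk by (intro dist_cbox_center) blast
        then have "dist w z < \<delta>"
          using zb \<delta> dist_triangle[of w z "(x j, y k)"] by linarith
        then show "norm (g w - g z) \<le> t" by (rule osc)
      qed
      then show ?thesis
        using \<beta>0 by (simp add: jk d_def norm_mult mult_right_mono)
    qed (simp add: jk d_def)
  qed
  have one: "((\<lambda>(j, k). \<beta> j k z) has_sum 1) (J \<times> J)"
    using \<beta> unfolding bupu_def by blast
  have bound: "((\<lambda>jk. M * t * (case jk of (j, k) \<Rightarrow> \<beta> j k z)) has_sum M * t) (J \<times> J)"
    using has_sum_cmult_right[OF one, of "M * t"] by simp
  have "d summable_on J \<times> J"
    by (rule abs_summable_summable, rule Infinite_Sum.abs_summable_on_comparison_test'[OF _ d_le])
       (use bound in \<open>auto simp: summable_on_def\<close>)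
  then have d_sum: "(d has_sum infsum d (J \<times> J)) (J \<times> J)"
    by simp
  have "((\<lambda>jk. g z * of_real (case jk of (j, k) \<Rightarrow> \<beta> j k z)) has_sum g z * of_real 1) (J \<times> J)"
    by (intro has_sum_cmult_right) (simp only: has_sum_of_real_iff one)
  from has_sum_add[OF d_sum this]
  have sum: "((\<lambda>(j, k). pairing g (\<psi> j k) * of_real (\<beta> j k z)) has_sum (infsum d (J \<times> J) + g z)) (J \<times> J)"
    by (simp add: d_def split_beta' algebra_simps)
  then show "(\<lambda>(j, k). pairing g (\<psi> j k) * of_real (\<beta> j k z)) summable_on J \<times> J"
    by (auto simp: summable_on_def)
  have "sampling_operator J \<psi> \<beta> g z = infsum d (J \<times> J) + g z"
    unfolding sampling_operator_def using sum by (rule infsumI)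
  then show "norm (g z - sampling_operator J \<psi> \<beta> g z) \<le> M * t"
    using norm_infsum_le[OF d_sum bound d_le] by simp
qed

lemma borel_measurable_infsum_countable:
  fixes f :: "'i::countable \<Rightarrow> 'a \<Rightarrow> complex"
  assumes f: "\<And>i. i \<in> I \<Longrightarrow> f i \<in> borel_measurable N" and sum: "\<And>z. (\<lambda>i. f i z) summable_on I"
  shows "(\<lambda>z. \<Sum>\<^sub>\<infinity>i\<in>I. f i z) \<in> borel_measurable N"
proof -
  define h where "h = (\<lambda>n z. if n \<in> to_nat ` I then f (from_nat n) z else 0)"
  have [measurable]: "h n \<in> borel_measurable N" for n
    by (cases "n \<in> to_nat ` I") (auto simp: h_def f)
  have "(\<Sum>\<^sub>\<infinity>i\<in>I. f i z) = (\<Sum>n. h n z)" for z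
  proof -
    have "((\<lambda>i. f i z) has_sum (\<Sum>\<^sub>\<infinity>i\<in>I. f i z)) I"
      using sum by simp
    then have "((\<lambda>n. h n z) has_sum (\<Sum>\<^sub>\<infinity>i\<in>I. f i z)) (to_nat ` I)"
      by (subst has_sum_reindex) (auto simp: h_def o_def inj_on_def cong: has_sum_cong)
    then have "((\<lambda>n. h n z) has_sum (\<Sum>\<^sub>\<infinity>i\<in>I. f i z)) UNIV"
      by (rule has_sum_cong_neutral[THEN iffD1, rotated -1]) (auto simp: h_def)
    then show ?thesis
      using has_sum_imp_sums sums_unique by blast
  qed
  then show ?thesis by simp
qed

text \<open>
  A continuous \<open>g\<close> is bounded near each point, so the series converges everywhere and its sum is
  a pointwise limit of measurable functions.
\<close>

lemma sampling_operator_measurable: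
  fixes g :: "'d::finite cfun"
  assumes \<beta>: "bupu J x y \<gamma> \<beta>" and \<psi>: "averaging_functions J M \<psi>"
    and supp: "\<forall>j\<in>J. \<forall>k\<in>J. supp (\<psi> j k) \<subseteq> cbox ((x j, y k) - a *\<^sub>R One) ((x j, y k) + a *\<^sub>R One)"
    and g: "continuous_on UNIV g"
  shows "sampling_operator J \<psi> \<beta> g \<in> borel_measurable lebesgue"
proof -
  define \<delta> where "\<delta> = \<gamma> + a * DIM(real \<times> (real^'d))"
  have "(\<lambda>jk. (case jk of (j, k) \<Rightarrow> \<lambda>z. pairing g (\<psi> j k) * of_real (\<beta> j k z)) z) summable_on J \<times> J" for z
  proof -
    have "compact ((\<lambda>w. g w - g z) ` cball z \<delta>)"
      by (intro compact_continuous_image continuous_intros continuous_on_subset[OF g]) auto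
    then obtain t where "\<forall>w\<in>cball z \<delta>. norm (g w - g z) \<le> t"
      by (auto dest!: compact_imp_bounded simp: bounded_iff)
    then have "(\<lambda>(j, k). pairing g (\<psi> j k) * of_real (\<beta> j k z)) summable_on J \<times> J"
      by (intro sampling_error(1)[OF \<beta> \<psi> supp _ g, of \<delta> z t]) (auto simp: \<delta>_def dist_commute)
    then show ?thesis by (simp add: split_beta')
  qed
  then have "(\<lambda>z. \<Sum>\<^sub>\<infinity>jk\<in>J \<times> J. (case jk of (j, k) \<Rightarrow> \<lambda>z. pairing g (\<psi> j k) * of_real (\<beta> j k z)) z)
      \<in> borel_measurable lebesgue"
    by (rule borel_measurable_infsum_countable[rotated])
       (use \<beta> in \<open>auto simp: bupu_def intro!: borel_measurable_times borel_measurable_const measurable_compose[OF _ borel_measurable_of_real]\<close>)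
  then show ?thesis
    unfolding sampling_operator_def by (simp add: split_beta')
qed

lemma sampling_operator_cong_AE:
  fixes f g :: "'d::finite cfun"
  assumes "averaging_functions J M \<psi>" "AE z in lebesgue. f z = g z"
    and "f \<in> borel_measurable lebesgue" "g \<in> borel_measurable lebesgue"
  shows "sampling_operator J \<psi> \<beta> f = sampling_operator J \<psi> \<beta> g"
proof -
  have "pairing f (\<psi> j k) = pairing g (\<psi> j k)" if "j \<in> J" "k \<in> J" for j k
  proof -
    have [measurable]: "\<psi> j k \<in> borel_measurable lebesgue"
      using assms(1) that by (simp add: averaging_functions_def wiener_def)
    note [measurable] = assms(3,4)
    show ?thesis
      unfolding pairing_def
    proof (rule integral_cong_AE)
      show "AE z in lebesgue. f z * cnj (\<psi> j k z) = g z * cnj (\<psi> j k z)"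
        using assms(2) by eventually_elim simp
    qed measurable
  qed
  then show ?thesis
    unfolding sampling_operator_def by (intro ext infsum_cong) auto
qed

text \<open>
  The averages see only the class of \<open>h\<close> modulo null sets, so \<open>h\<close> may be replaced by its locally
  spanned, hence continuous, representative \<open>g\<close>. There the pointwise error bound applies.
\<close>

lemma sampling_operator_approximates:
  fixes g h :: "'d::finite cfun"
  assumes p: "1 \<le> p" and q: "1 \<le> q"
    and e: "\<And>i. i \<in> I \<Longrightarrow> continuous_on UNIV (e i)"
    and bound: "\<And>g D :: 'd cfun. locally_spanned I e g \<Longrightarrow> dominated_by_oscillation \<delta> M g D \<Longrightarrow>
       Lpq_norm p q D \<le> ennreal \<epsilon> * Lpq_norm p q g"
    and \<beta>: "bupu J x y \<gamma> \<beta>" and \<psi>: "averaging_functions J M \<psi>"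
    and supp: "\<forall>j\<in>J. \<forall>k\<in>J. supp (\<psi> j k) \<subseteq> cbox ((x j, y k) - a *\<^sub>R One) ((x j, y k) + a *\<^sub>R One)"
    and \<delta>: "\<gamma> + a * DIM(real \<times> (real^'d)) \<le> \<delta>"
    and h: "h \<in> Lpq p q" and g: "locally_spanned I e g" and hg: "AE z in lebesgue. h z = g z"
  shows "sampling_operator J \<psi> \<beta> h \<in> Lpq p q"
    and "Lpq_norm p q (\<lambda>z. h z - sampling_operator J \<psi> \<beta> h z) \<le> ennreal \<epsilon> * Lpq_norm p q h"
proof -
  have cont: "continuous_on UNIV g" by (rule locally_spanned_continuous[OF e g])
  have gm: "g \<in> borel_measurable lebesgue"
    using borel_measurable_continuous_onI[OF cont] by (intro measurable_completion) simp
  have hm: "h \<in> borel_measurable lebesgue" using h by (simp add: Lpq_def)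
  have eq: "sampling_operator J \<psi> \<beta> h = sampling_operator J \<psi> \<beta> g"
    by (rule sampling_operator_cong_AE[OF \<psi> hg hm gm])
  have sm: "sampling_operator J \<psi> \<beta> g \<in> borel_measurable lebesgue"
    by (rule sampling_operator_measurable[OF \<beta> \<psi> supp cont])
  have "Lpq_norm p q (\<lambda>z. h z - sampling_operator J \<psi> \<beta> g z)
      = Lpq_norm p q (\<lambda>z. g z - sampling_operator J \<psi> \<beta> g z)"
    using hg by (intro Lpq_norm_cong_AE p q) (auto elim: eventually_mono)
  also have "\<dots> \<le> ennreal \<epsilon> * Lpq_norm p q g"
  proof (rule bound[OF g])
    show "dominated_by_oscillation \<delta> M g (\<lambda>z. g z - sampling_operator J \<psi> \<beta> g z)"
      unfolding dominated_by_oscillation_def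
      using sampling_error(2)[OF \<beta> \<psi> supp \<delta> cont] by blast
  qed
  also have "Lpq_norm p q g = Lpq_norm p q h"
    by (rule Lpq_norm_cong_AE[OF p q hg, symmetric])
  finally show *: "Lpq_norm p q (\<lambda>z. h z - sampling_operator J \<psi> \<beta> h z) \<le> ennreal \<epsilon> * Lpq_norm p q h"
    by (simp add: eq)
  have "Lpq_norm p q h < \<infinity>" using h by (simp add: Lpq_def)
  then have "(\<lambda>z. h z - sampling_operator J \<psi> \<beta> h z) \<in> Lpq p q"
    using hm sm order.strict_trans1[OF *, of top] by (simp add: Lpq_def eq ennreal_mult_less_top)
  from Lpq_diff[OF p q h this] show "sampling_operator J \<psi> \<beta> h \<in> Lpq p q"
    by simp
qed

section \<open>The iterative algorithm\<close>

lemma projection_diff_AE: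
  assumes "bounded_projection_onto p q P V" "f \<in> Lpq p q" "g \<in> Lpq p q"
  shows "AE z in lebesgue. P (\<lambda>w. f w - g w) z = P f z - P g z"
proof -
  have "\<forall>f\<in>Lpq p q. \<forall>g\<in>Lpq p q. AE z in lebesgue. P (\<lambda>w. f w + g w) z = P f z + P g z"
    using assms(1) unfolding bounded_projection_onto_def by (elim conjE)
  from bspec[OF bspec[OF this assms(2)] Lpq_uminus[OF assms(3)]]
  have add: "AE z in lebesgue. P (\<lambda>w. f w + (- 1) * g w) z = P f z + P (\<lambda>w. (- 1) * g w) z" .
  have scale: "AE z in lebesgue. P (\<lambda>w. (- 1) * g w) z = (- 1) * P g z"
    using assms unfolding bounded_projection_onto_def by blast
  from add scale show ?thesis
    by eventually_elim simp
qed

text \<open>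
  The operator is only given on representatives, with \<open>v = P f\<close> almost everywhere. Idempotence gives
  \<open>P (P f) = P f\<close>, and boundedness turns \<open>\<parallel>P f - v\<parallel> = 0\<close> into \<open>P (P f) = P v\<close>, almost everywhere.
\<close>

lemma projection_fixes:
  fixes v :: "'d::finite cfun"
  assumes p: "1 \<le> p" and q: "1 \<le> q" and P: "bounded_projection_onto p q P V"
    and v: "v \<in> V" "v \<in> borel_measurable lebesgue"
  shows "v \<in> Lpq p q" and "AE z in lebesgue. P v z = v z"
proof -
  obtain f where f: "f \<in> Lpq p q" and eq: "AE z in lebesgue. P f z = v z"
    using P v(1) unfolding bounded_projection_onto_def by blast
  have Pf: "P f \<in> Lpq p q" and idem: "AE z in lebesgue. P (P f) z = P f z"
    using P f unfolding bounded_projection_onto_def by blast+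
  show vL: "v \<in> Lpq p q"
    by (rule Lpq_cong_AE[OF p q eq Pf v(2)])
  define d where "d = (\<lambda>z. P f z - v z)"
  have d: "d \<in> Lpq p q"
    unfolding d_def by (rule Lpq_diff[OF p q Pf vL])
  have "Lpq_norm p q d = Lpq_norm p q ((\<lambda>z. 0) :: 'd cfun)"
    using eq by (intro Lpq_norm_cong_AE p q) (auto simp: d_def elim: eventually_mono)
  also have "\<dots> = 0"
    by (simp add: Lpq_norm_slice slice_integral_def)
  finally have "Lpq_norm p q d = 0" .
  moreover obtain B :: real where "Lpq_norm p q (P d) \<le> ennreal B * Lpq_norm p q d"
    using P d unfolding bounded_projection_onto_def by blast
  ultimately have "Lpq_norm p q (P d) = 0" by simp
  moreover have "P d \<in> borel_measurable lebesgue"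
    using P d unfolding bounded_projection_onto_def Lpq_def by blast
  ultimately have "AE z in lebesgue. P d z = 0"
    by (intro Lpq_norm_eq_0_AE[OF p q])
  moreover have "AE z in lebesgue. P d z = P (P f) z - P v z"
    unfolding d_def by (rule projection_diff_AE[OF P Pf vL])
  ultimately show "AE z in lebesgue. P v z = v z"
    using idem eq by eventually_elim simp
qed

theorem theorem3p4:
  fixes p q M :: real
    and r :: nat
    and \<Phi> :: "nat \<Rightarrow> real \<times> (real^'d::finite) \<Rightarrow> complex"
    and P :: "(real \<times> (real^'d) \<Rightarrow> complex) \<Rightarrow> (real \<times> (real^'d) \<Rightarrow> complex)"
  assumes "1 \<le> p" and "1 \<le> q" and "1 \<le> r"
    and "\<forall>i\<in>{1..r}. \<Phi> i \<in> wiener0 1 1 \<and> compact (supp (\<Phi> i))"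
    and "bounded_projection_onto p q P (shift_inv_space p q r \<Phi>)"
    and "M > 0"
  shows "\<exists>\<gamma>0>0. \<exists>a0>0. \<forall>\<gamma> a. 0 < \<gamma> \<and> \<gamma> \<le> \<gamma>0 \<and> 0 < a \<and> a \<le> a0 \<longrightarrow>
    (\<exists>\<alpha>::real. 0 \<le> \<alpha> \<and> \<alpha> < 1 \<and>
      (\<forall>(J::nat set) (x::nat \<Rightarrow> real) (y::nat \<Rightarrow> real^'d)
         (\<beta>::nat \<Rightarrow> nat \<Rightarrow> real \<times> (real^'d) \<Rightarrow> real)
         (\<psi>::nat \<Rightarrow> nat \<Rightarrow> real \<times> (real^'d) \<Rightarrow> complex).
        dense_samples J x y \<gamma> \<and> bupu J x y \<gamma> \<beta> \<and> averaging_functions J M \<psi> \<and>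
        (\<forall>j\<in>J. \<forall>k\<in>J. supp (\<psi> j k) \<subseteq> cbox ((x j, y k) - a *\<^sub>R One) ((x j, y k) + a *\<^sub>R One)) \<longrightarrow>
        (\<forall>f\<in>shift_inv_space p q r \<Phi>. \<forall>F::nat \<Rightarrow> real \<times> (real^'d) \<Rightarrow> complex.
          F 1 = P (sampling_operator J \<psi> \<beta> f) \<and>
          (\<forall>n\<ge>1. F (n + 1) = (\<lambda>z. P (sampling_operator J \<psi> \<beta> (\<lambda>w. f w - F n w)) z + F n z)) \<longrightarrow>
          (\<forall>n\<ge>1. F n \<in> Lpq p q) \<and>
          (\<lambda>n. Lpq_norm p q (\<lambda>z. f z - F n z)) \<longlonglongrightarrow> 0 \<and>
          (\<exists>C::real. 0 \<le> C \<and> (\<forall>n\<ge>1. Lpq_norm p q (\<lambda>z. f z - F n z) \<le> ennreal (C * \<alpha> ^ n))))))"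
proof -
  note p = assms(1) and q = assms(2)
  define V where "V = shift_inv_space p q r \<Phi>"
  note P = assms(5)[folded V_def]
  obtain \<Lambda> where \<Lambda>: "finite \<Lambda>" and series:
    "\<And>c. locally_spanned ({1..r} \<times> \<Lambda>) (\<lambda>(i, k) u. \<Phi> i (u - lattice_point k))
      (\<lambda>z. \<Sum>i=1..r. \<Sum>\<^sub>\<infinity>(k, l)\<in>UNIV. c i (k, l) * \<Phi> i (fst z - of_int k, snd z - int_vec l))"
    using shift_series_locally_spanned[of r \<Phi>] assms(4) by blast
  define I where "I = {1..r} \<times> \<Lambda>"
  define e where "e = (\<lambda>(i, k) u. \<Phi> i (u - lattice_point k))"
  have I: "finite I" using \<Lambda> by (simp add: I_def)
  have e: "continuous_on UNIV (e i)" if "i \<in> I" for i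
  proof -
    from that have "i \<in> {1..r} \<times> \<Lambda>" by (simp only: I_def)
    then obtain i' k where i: "i = (i', k)" "i' \<in> {1..r}" by blast
    then have "continuous_on UNIV (\<Phi> i')" using assms(4) by (auto simp: wiener0_def)
    then have "continuous_on UNIV (\<lambda>u. \<Phi> i' (u - lattice_point k))"
      by (rule continuous_on_compose2) (auto intro!: continuous_intros)
    then show ?thesis by (simp add: e_def i)
  qed
  obtain B0 :: real where B0: "\<And>f. f \<in> Lpq p q \<Longrightarrow> Lpq_norm p q (P f) \<le> ennreal B0 * Lpq_norm p q f"
    using P unfolding bounded_projection_onto_def by blast
  define B where "B = max B0 0"
  have B: "0 \<le> B" "ennreal B0 = ennreal B" by (auto simp: B_def max_def ennreal_neg)
  \<comment> \<open>makes the contraction factor \<open>B * \<epsilon>\<close> at most one half, whatever the norm of the projection\<close>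
  define \<epsilon> where "\<epsilon> = 1 / (2 * (B + 1))"
  have \<epsilon>: "0 < \<epsilon>" "B * \<epsilon> \<le> 1 / 2" using B(1) by (auto simp: \<epsilon>_def field_simps)
  have M: "0 \<le> M" using assms(6) by simp
  obtain \<delta> where \<delta>: "0 < \<delta>" and bound: "\<And>g D :: 'd cfun. locally_spanned I e g \<Longrightarrow> dominated_by_oscillation \<delta> M g D \<Longrightarrow>
       Lpq_norm p q D \<le> ennreal \<epsilon> * Lpq_norm p q g"
    by (rule oscillation_norm_bound[OF p q M \<epsilon>(1) I, of e], rule e, assumption, rule that)
  \<comment> \<open>A class closed under differences that contains the whole shift-invariant space: all errors \<open>f - F n\<close> stay in it.\<close>
  define Inv where "Inv = (\<lambda>h. h \<in> Lpq p q \<and> (AE z in lebesgue. P h z = h z) \<and>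
      (\<exists>g. locally_spanned I e g \<and> (AE z in lebesgue. h z = g z)))"
  have Inv_V: "Inv v" if v: "v \<in> V" for v
  proof -
    obtain c where c: "AE z in lebesgue. v z = (\<Sum>i=1..r. \<Sum>\<^sub>\<infinity>(k, l)\<in>UNIV. c i (k, l) * \<Phi> i (fst z - of_int k, snd z - int_vec l))"
      and vm: "v \<in> borel_measurable lebesgue"
      using v unfolding V_def shift_inv_space_def by blast
    show ?thesis
      unfolding Inv_def I_def e_def using series c projection_fixes[OF p q P v vm] by blast
  qed
  have Inv_diff: "Inv (\<lambda>z. h z - h' z)" if h: "Inv h" and h': "Inv h'" for h h'
  proof -
    have L: "h \<in> Lpq p q" "h' \<in> Lpq p q"
      and fixed: "AE z in lebesgue. P h z = h z" "AE z in lebesgue. P h' z = h' z"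
      using h h' unfolding Inv_def by blast+
    obtain g g' where g: "locally_spanned I e g" "AE z in lebesgue. h z = g z"
      and g': "locally_spanned I e g'" "AE z in lebesgue. h' z = g' z"
      using h h' unfolding Inv_def by blast
    have "AE z in lebesgue. P (\<lambda>z. h z - h' z) z = h z - h' z"
      using projection_diff_AE[OF P L] fixed by eventually_elim simp
    moreover have "AE z in lebesgue. h z - h' z = g z - g' z"
      using g(2) g'(2) by eventually_elim simp
    ultimately show ?thesis
      unfolding Inv_def using Lpq_diff[OF p q L] locally_spanned_diff[OF g(1) g'(1)] by blast
  qed
  show ?thesis
  proof (rule exI[of _ "\<delta> / 2"], rule conjI[rotated],
      rule exI[of _ "\<delta> / (2 * DIM(real \<times> (real^'d)))"], rule conjI[rotated], (rule allI impI)+)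
    fix \<gamma> a :: real
    assume \<gamma>a: "0 < \<gamma> \<and> \<gamma> \<le> \<delta> / 2 \<and> 0 < a \<and> a \<le> \<delta> / (2 * DIM(real \<times> (real^'d)))"
    \<comment> \<open>half of \<open>\<delta>\<close> is spent on the distance from a point to the sample centres, half on the supports of the averaging functions\<close>
    define n where "n = real DIM(real \<times> (real^'d))"
    have "0 < n" unfolding n_def by (simp only: of_nat_0_less_iff DIM_positive)
    moreover have "a \<le> \<delta> / (2 * n)" using \<gamma>a by (simp add: n_def)
    ultimately have "a * n \<le> \<delta> / 2" by (simp add: field_simps)
    then have small: "\<gamma> + a * DIM(real \<times> (real^'d)) \<le> \<delta>"
      unfolding n_def using \<gamma>a by linarith
    show "\<exists>\<alpha>::real. 0 \<le> \<alpha> \<and> \<alpha> < 1 \<and>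
      (\<forall>(J::nat set) (x::nat \<Rightarrow> real) (y::nat \<Rightarrow> real^'d)
         (\<beta>::nat \<Rightarrow> nat \<Rightarrow> real \<times> (real^'d) \<Rightarrow> real)
         (\<psi>::nat \<Rightarrow> nat \<Rightarrow> real \<times> (real^'d) \<Rightarrow> complex).
        dense_samples J x y \<gamma> \<and> bupu J x y \<gamma> \<beta> \<and> averaging_functions J M \<psi> \<and>
        (\<forall>j\<in>J. \<forall>k\<in>J. supp (\<psi> j k) \<subseteq> cbox ((x j, y k) - a *\<^sub>R One) ((x j, y k) + a *\<^sub>R One)) \<longrightarrow>
        (\<forall>f\<in>shift_inv_space p q r \<Phi>. \<forall>F::nat \<Rightarrow> real \<times> (real^'d) \<Rightarrow> complex.
          F 1 = P (sampling_operator J \<psi> \<beta> f) \<and>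
          (\<forall>n\<ge>1. F (n + 1) = (\<lambda>z. P (sampling_operator J \<psi> \<beta> (\<lambda>w. f w - F n w)) z + F n z)) \<longrightarrow>
          (\<forall>n\<ge>1. F n \<in> Lpq p q) \<and>
          (\<lambda>n. Lpq_norm p q (\<lambda>z. f z - F n z)) \<longlonglongrightarrow> 0 \<and>
          (\<exists>C::real. 0 \<le> C \<and> (\<forall>n\<ge>1. Lpq_norm p q (\<lambda>z. f z - F n z) \<le> ennreal (C * \<alpha> ^ n)))))"
    proof (rule exI[of _ "1 / 2"], intro conjI[OF _ conjI] allI impI ballI)
      fix J :: "nat set" and x :: "nat \<Rightarrow> real" and y :: "nat \<Rightarrow> real^'d" and \<beta> \<psi> f
        and F :: "nat \<Rightarrow> real \<times> (real^'d) \<Rightarrow> complex"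
      assume sampling: "dense_samples J x y \<gamma> \<and> bupu J x y \<gamma> \<beta> \<and> averaging_functions J M \<psi> \<and>
        (\<forall>j\<in>J. \<forall>k\<in>J. supp (\<psi> j k) \<subseteq> cbox ((x j, y k) - a *\<^sub>R One) ((x j, y k) + a *\<^sub>R One))"
        and "f \<in> shift_inv_space p q r \<Phi>"
        and F: "F 1 = P (sampling_operator J \<psi> \<beta> f) \<and>
          (\<forall>n\<ge>1. F (n + 1) = (\<lambda>z. P (sampling_operator J \<psi> \<beta> (\<lambda>w. f w - F n w)) z + F n z))"
      then have Inv_f: "Inv f" by (intro Inv_V) (simp add: V_def)
      then have f: "f \<in> Lpq p q" unfolding Inv_def by blast
      define S where "S = sampling_operator J \<psi> \<beta>"
      have half: "Inv (\<lambda>z. h z - P (S h) z) \<and>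
          Lpq_norm p q (\<lambda>z. h z - P (S h) z) \<le> ennreal (1 / 2) * Lpq_norm p q h" if h: "Inv h" for h
      proof -
        obtain g where g: "locally_spanned I e g" "AE z in lebesgue. h z = g z"
          using h unfolding Inv_def by blast
        have hL: "h \<in> Lpq p q" and fixed: "AE z in lebesgue. P h z = h z"
          using h unfolding Inv_def by blast+
        have SL: "S h \<in> Lpq p q"
          and S_le: "Lpq_norm p q (\<lambda>z. h z - S h z) \<le> ennreal \<epsilon> * Lpq_norm p q h"
          unfolding S_def
          using sampling_operator_approximates[OF p q e bound _ _ _ small hL g] sampling by blast+
        have "P (S h) \<in> V" using P SL unfolding bounded_projection_onto_def by blast
        then have inv: "Inv (\<lambda>z. h z - P (S h) z)" by (intro Inv_diff h Inv_V)
        \<comment> \<open>the new error is the projection of the sampling error, because \<open>P\<close> fixes \<open>h\<close>\<close>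
        have "AE z in lebesgue. h z - P (S h) z = P (\<lambda>w. h w - S h w) z"
          using projection_diff_AE[OF P hL SL] fixed by eventually_elim simp
        then have "Lpq_norm p q (\<lambda>z. h z - P (S h) z) = Lpq_norm p q (P (\<lambda>w. h w - S h w))"
          by (rule Lpq_norm_cong_AE[OF p q])
        also have "\<dots> \<le> ennreal B * Lpq_norm p q (\<lambda>w. h w - S h w)"
          using B0[OF Lpq_diff[OF p q hL SL]] B(2) by simp
        also have "\<dots> \<le> ennreal B * (ennreal \<epsilon> * Lpq_norm p q h)"
          by (intro mult_left_mono S_le) simp
        also have "\<dots> = ennreal (B * \<epsilon>) * Lpq_norm p q h"
          using B \<epsilon> by (simp add: ennreal_mult mult.assoc)
        also have "\<dots> \<le> ennreal (1 / 2) * Lpq_norm p q h"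
          using \<epsilon>(2) by (intro mult_right_mono ennreal_leI) auto
        finally show ?thesis using inv by blast
      qed
      define C where "C = enn2real (Lpq_norm p q f)"
      have C: "Lpq_norm p q f = ennreal C"
        using f by (simp add: C_def Lpq_def)
      have error: "Inv (\<lambda>z. f z - F n z) \<and> Lpq_norm p q (\<lambda>z. f z - F n z) \<le> ennreal (C * (1 / 2) ^ n)"
        if "1 \<le> n" for n
        using that
      proof (induction n rule: dec_induct)
        case base
        have eq: "(\<lambda>z. f z - F 1 z) = (\<lambda>z. f z - P (S f) z)"
          using F by (simp add: S_def)
        have "ennreal (1 / 2) * Lpq_norm p q f = ennreal (C * (1 / 2) ^ 1)"
          by (simp only: C ennreal_mult'[symmetric] power_one_right mult.commute[of C])
        then show ?case
          unfolding eq using half[OF Inv_f] by simp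
      next
        case (step n)
        define h where "h = (\<lambda>z. f z - F n z)"
        have eq: "(\<lambda>z. f z - F (Suc n) z) = (\<lambda>z. h z - P (S h) z)"
          using F step.hyps by (auto simp: S_def h_def)
        have IH: "Inv h" "Lpq_norm p q h \<le> ennreal (C * (1 / 2) ^ n)"
          using step.IH by (auto simp: h_def)
        have "Lpq_norm p q (\<lambda>z. h z - P (S h) z) \<le> ennreal (1 / 2) * Lpq_norm p q h"
          using half[OF IH(1)] by blast
        also have "\<dots> \<le> ennreal (1 / 2) * ennreal (C * (1 / 2) ^ n)"
          by (intro mult_left_mono IH) simp
        also have "\<dots> = ennreal (C * (1 / 2) ^ Suc n)"
          by (subst ennreal_mult'[symmetric]) (simp_all add: mult.left_commute)
        finally show ?case
          unfolding eq using half[OF IH(1)] by blast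
      qed
      show "F n \<in> Lpq p q" if "1 \<le> n" for n
      proof -
        have "(\<lambda>z. f z - F n z) \<in> Lpq p q"
          using error[OF that] unfolding Inv_def by blast
        from Lpq_diff[OF p q f this] show ?thesis by simp
      qed
      show "\<exists>C\<ge>0. \<forall>n\<ge>1. Lpq_norm p q (\<lambda>z. f z - F n z) \<le> ennreal (C * (1 / 2) ^ n)"
        using error by (intro exI[of _ C]) (auto simp: C_def)
      show "(\<lambda>n. Lpq_norm p q (\<lambda>z. f z - F n z)) \<longlonglongrightarrow> 0"
      proof (rule tendsto_sandwich[of "\<lambda>_. 0"])
        show "\<forall>\<^sub>F n in sequentially. Lpq_norm p q (\<lambda>z. f z - F n z) \<le> ennreal (C * (1 / 2) ^ n)"
          using eventually_ge_at_top[of 1] by eventually_elim (use error in blast)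
        have "(\<lambda>n. C * (1 / 2) ^ n) \<longlonglongrightarrow> C * 0"
          by (intro tendsto_mult_left LIMSEQ_power_zero) simp
        then show "(\<lambda>n. ennreal (C * (1 / 2) ^ n)) \<longlonglongrightarrow> 0"
          using tendsto_ennrealI by fastforce
      qed auto
    qed auto
  qed (use \<delta> in auto)
qed

end
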